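(* Let $0<m<\infty$ and let $(M,g)$ be a compact smooth Riemannian manifold. If $V$ is an $m$-modified homothetic vector field on $(M,g)$, i.e. a smooth vector field satisfying $\frac12\mathcal{L}_V g-\frac1m v\otimes v=\sigma g$ for some real constant $\sigma$, then $V$ is trivial, that is, $V=0$ identically on $M$.
   Context: $\mathcal{L}_V$ denotes the Lie derivative along $V$, and $v=g(V,\cdot)$ is the $1$-form metrically associated to $V$. For $0<m<\infty$, a smooth vector field $V$ on $(M,g)$ is called an $m$-modified homothetic vector field if there is a real constant $\sigma$ with $\frac12\mathcal{L}_V g-\frac1m v\otimes v=\sigma g$. It is called trivial when $V=0$.
   Formalization: The manifold is assumed to have dimension at least 2: in dimension 1 the claim fails, since on the circle with g = dθ² the field V = c ∂/∂θ, c ≠ 0, satisfies the equation with σ = −c²/m but is not zero; dimension 0, where V = 0 automatically, is also left out. *)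

theory Defs
  imports "HOL-Analysis.Analysis"
begin

text \<open>
  \<open>Ck_on k S f\<close> is meant for open \<open>S\<close>: all directional derivatives of \<open>f\<close> of order at most \<open>k\<close>
  exist and are continuous on \<open>S\<close>.
\<close>

primrec Ck_on ::
  "nat \<Rightarrow> 'a::euclidean_space set \<Rightarrow> ('a \<Rightarrow> 'b::real_normed_vector) \<Rightarrow> bool"
where
  "Ck_on 0 S f \<longleftrightarrow> continuous_on S f"
| "Ck_on (Suc k) S f \<longleftrightarrow>
     (\<forall>x\<in>S. f differentiable (at x)) \<and>
     (\<forall>u. Ck_on k S (\<lambda>x. frechet_derivative f (at x) u))"

definition smooth_on :: "'a::euclidean_space set \<Rightarrow> ('a \<Rightarrow> 'b::real_normed_vector) \<Rightarrow> bool"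
  where "smooth_on S f \<longleftrightarrow> (\<forall>k. Ck_on k S f)"

text \<open>
  A chart is a pair \<open>(U, \<phi>)\<close> of a domain and a coordinate map into the Euclidean model space \<open>'e\<close>;
  only the values of \<open>\<phi>\<close> on \<open>U\<close> matter. The dimension of the manifold is \<open>DIM('e)\<close>.
\<close>

type_synonym ('m, 'e) chart = "'m set \<times> ('m \<Rightarrow> 'e)"

abbreviation chart_dom :: "('m, 'e) chart \<Rightarrow> 'm set"
  where "chart_dom \<equiv> fst"

abbreviation chart_map :: "('m, 'e) chart \<Rightarrow> 'm \<Rightarrow> 'e"
  where "chart_map \<equiv> snd"

definition chart_image :: "('m, 'e) chart \<Rightarrow> 'e set"
  where "chart_image c = chart_map c ` chart_dom c"

definition chart_inv :: "('m, 'e) chart \<Rightarrow> 'e \<Rightarrow> 'm"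
  where "chart_inv c = inv_into (chart_dom c) (chart_map c)"

definition transition :: "('m, 'e) chart \<Rightarrow> ('m, 'e) chart \<Rightarrow> 'e \<Rightarrow> 'e"
  where "transition c d = chart_map d \<circ> chart_inv c"

definition transition_deriv ::
  "('m, 'e::euclidean_space) chart \<Rightarrow> ('m, 'e) chart \<Rightarrow> 'm \<Rightarrow> 'e \<Rightarrow> 'e"
  where "transition_deriv c d p = frechet_derivative (transition c d) (at (chart_map c p))"

text \<open>
  A smooth manifold without boundary; it need not be connected. The atlas need not be maximal: any
  smooth atlas determines the smooth structure.
\<close>

locale smooth_manifold =
  fixes X :: "'m topology" and atlas :: "('m, 'e::euclidean_space) chart set"
  assumes Hausdorff: "Hausdorff_space X"
    and second_countable: "second_countable X"
    and cover: "(\<Union>c\<in>atlas. chart_dom c) = topspace X"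
    and open_dom: "c \<in> atlas \<Longrightarrow> openin X (chart_dom c)"
    and open_image: "c \<in> atlas \<Longrightarrow> open (chart_image c)"
    and homeo: "c \<in> atlas \<Longrightarrow>
      homeomorphic_map (subtopology X (chart_dom c)) (top_of_set (chart_image c)) (chart_map c)"
    and smooth_transition: "c \<in> atlas \<Longrightarrow> d \<in> atlas \<Longrightarrow>
      smooth_on (chart_map c ` (chart_dom c \<inter> chart_dom d)) (transition c d)"
begin

text \<open>
  A tangent vector at \<open>p\<close> is the family of its coordinate vectors in all charts around \<open>p\<close>, related by
  the derivatives of the transition maps. The value \<open>0\<close> at charts not containing \<open>p\<close> is a convention
  that makes the representation unique. The vector space structure is pointwise.
\<close>

definition tangent_space :: "'m \<Rightarrow> (('m, 'e) chart \<Rightarrow> 'e) set"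
  where "tangent_space p =
    {\<xi>. (\<forall>c. \<not> (c \<in> atlas \<and> p \<in> chart_dom c) \<longrightarrow> \<xi> c = 0) \<and>
        (\<forall>c\<in>atlas. \<forall>d\<in>atlas. p \<in> chart_dom c \<and> p \<in> chart_dom d \<longrightarrow>
           \<xi> d = transition_deriv c d p (\<xi> c))}"

text \<open>The tangent vector at \<open>p\<close> whose coordinate vector in the chart \<open>c\<close> is \<open>u\<close>.\<close>

definition tangent_of :: "('m, 'e) chart \<Rightarrow> 'm \<Rightarrow> 'e \<Rightarrow> (('m, 'e) chart \<Rightarrow> 'e)"
  where "tangent_of c p u =
    (\<lambda>d. if d \<in> atlas \<and> p \<in> chart_dom d then transition_deriv c d p u else 0)"

definition local_field :: "('m \<Rightarrow> ('m, 'e) chart \<Rightarrow> 'e) \<Rightarrow> ('m, 'e) chart \<Rightarrow> 'e \<Rightarrow> 'e"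
  where "local_field V c x = V (chart_inv c x) c"

definition smooth_vector_field :: "('m \<Rightarrow> ('m, 'e) chart \<Rightarrow> 'e) \<Rightarrow> bool"
  where "smooth_vector_field V \<longleftrightarrow>
    (\<forall>p\<in>topspace X. V p \<in> tangent_space p) \<and>
    (\<forall>c\<in>atlas. smooth_on (chart_image c) (local_field V c))"

definition zero_field :: "('m \<Rightarrow> ('m, 'e) chart \<Rightarrow> 'e) \<Rightarrow> bool"
  where "zero_field V \<longleftrightarrow> (\<forall>p\<in>topspace X. V p = (\<lambda>c. 0))"

text \<open>
  For a covariant 2-tensor field \<open>g\<close>, the bilinear form \<open>\<Sum>\<^sub>i\<^sub>j g\<^sub>i\<^sub>j(x) u\<^sup>i w\<^sup>j\<close> on the model space.
\<close>

definition local_form ::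
  "('m \<Rightarrow> (('m, 'e) chart \<Rightarrow> 'e) \<Rightarrow> (('m, 'e) chart \<Rightarrow> 'e) \<Rightarrow> real) \<Rightarrow>
   ('m, 'e) chart \<Rightarrow> 'e \<Rightarrow> 'e \<Rightarrow> 'e \<Rightarrow> real"
  where "local_form g c x u w =
    g (chart_inv c x) (tangent_of c (chart_inv c x) u) (tangent_of c (chart_inv c x) w)"

end

locale riemannian_manifold = smooth_manifold X atlas
  for X :: "'m topology" and atlas :: "('m, 'e::euclidean_space) chart set" +
  fixes g :: "'m \<Rightarrow> (('m, 'e) chart \<Rightarrow> 'e) \<Rightarrow> (('m, 'e) chart \<Rightarrow> 'e) \<Rightarrow> real"
  assumes metric_sym: "\<lbrakk>p \<in> topspace X; \<xi> \<in> tangent_space p; \<eta> \<in> tangent_space p\<rbrakk> \<Longrightarrow>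
      g p \<xi> \<eta> = g p \<eta> \<xi>"
    and metric_add: "\<lbrakk>p \<in> topspace X; \<xi> \<in> tangent_space p; \<xi>' \<in> tangent_space p;
      \<eta> \<in> tangent_space p\<rbrakk> \<Longrightarrow> g p (\<lambda>c. \<xi> c + \<xi>' c) \<eta> = g p \<xi> \<eta> + g p \<xi>' \<eta>"
    and metric_scale: "\<lbrakk>p \<in> topspace X; \<xi> \<in> tangent_space p; \<eta> \<in> tangent_space p\<rbrakk> \<Longrightarrow>
      g p (\<lambda>c. r *\<^sub>R \<xi> c) \<eta> = r * g p \<xi> \<eta>"
    and metric_pos: "\<lbrakk>p \<in> topspace X; \<xi> \<in> tangent_space p; \<xi> \<noteq> (\<lambda>c. 0)\<rbrakk> \<Longrightarrow> g p \<xi> \<xi> > 0"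
    and metric_smooth: "c \<in> atlas \<Longrightarrow> smooth_on (chart_image c) (\<lambda>x. local_form g c x u w)"
begin

text \<open>The 1-form \<open>g(V, \<cdot>)\<close>.\<close>

definition flat :: "('m \<Rightarrow> ('m, 'e) chart \<Rightarrow> 'e) \<Rightarrow> 'm \<Rightarrow> (('m, 'e) chart \<Rightarrow> 'e) \<Rightarrow> real"
  where "flat V p \<xi> = g p (V p) \<xi>"

text \<open>
  The value at \<open>p\<close> on \<open>\<xi>, \<eta>\<close> of the Lie derivative of the metric along \<open>V\<close>, evaluated in a chart \<open>c\<close>
  around \<open>p\<close>: in coordinates
  \<open>(\<L>\<^sub>V g)\<^sub>i\<^sub>j = V\<^sup>k \<partial>\<^sub>k g\<^sub>i\<^sub>j + g\<^sub>k\<^sub>j \<partial>\<^sub>i V\<^sup>k + g\<^sub>i\<^sub>k \<partial>\<^sub>j V\<^sup>k\<close>.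
  Equivalently, this is \<open>V(g(Y,Z)) - g([V,Y],Z) - g(Y,[V,Z])\<close> for the vector fields \<open>Y, Z\<close> with
  constant coordinates in \<open>c\<close> and values \<open>\<xi>, \<eta>\<close> at \<open>p\<close>. It does not depend on the choice of \<open>c\<close>.
\<close>

definition lie_deriv_metric ::
  "('m \<Rightarrow> ('m, 'e) chart \<Rightarrow> 'e) \<Rightarrow> ('m, 'e) chart \<Rightarrow> 'm \<Rightarrow>
   (('m, 'e) chart \<Rightarrow> 'e) \<Rightarrow> (('m, 'e) chart \<Rightarrow> 'e) \<Rightarrow> real"
  where "lie_deriv_metric V c p \<xi> \<eta> =
    (let x = chart_map c p;
         DV = frechet_derivative (local_field V c) (at x)
     in frechet_derivative (\<lambda>y. local_form g c y (\<xi> c) (\<eta> c)) (at x) (local_field V c x)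
        + local_form g c x (DV (\<xi> c)) (\<eta> c)
        + local_form g c x (\<xi> c) (DV (\<eta> c)))"

definition modified_homothetic :: "real \<Rightarrow> ('m \<Rightarrow> ('m, 'e) chart \<Rightarrow> 'e) \<Rightarrow> bool"
  where "modified_homothetic m V \<longleftrightarrow>
    smooth_vector_field V \<and>
    (\<exists>\<sigma>. \<forall>c\<in>atlas. \<forall>p\<in>chart_dom c. \<forall>\<xi>\<in>tangent_space p. \<forall>\<eta>\<in>tangent_space p.
       1/2 * lie_deriv_metric V c p \<xi> \<eta> - 1/m * (flat V p \<xi> * flat V p \<eta>) = \<sigma> * g p \<xi> \<eta>)"

end

end

theory Submission
  imports Defs
begin

text \<open>
  Let \<open>f = g(V,V)\<close> and \<open>n = dim M\<close>. At a maximum of \<open>f\<close> the derivative \<open>V(f)\<close> vanishes, and the equation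
  evaluated on \<open>(V,V)\<close> gives \<open>\<sigma> f + f\<^sup>2/m = 0\<close>; so either \<open>V = 0\<close>, or \<open>\<sigma> < 0\<close> and \<open>f \<le> - m \<sigma>\<close>
  everywhere. In the second case the trace of the equation is
  \<open>div V = n \<sigma> + f/m \<le> (n - 1) \<sigma> < 0\<close>, which contradicts the divergence theorem on a compact manifold.
  The divergence theorem is obtained from integration by parts in single
  charts, a partition of unity, and the change of variables formula for the Riemannian densities.
\<close>

section \<open>Change of variables in Euclidean spaces\<close>

text \<open>The maximum of f decides so much because (L_V g)(V,V) = V(f): the bracket [V,V]
  vanishes. In the trace, half of tr_g (L_V g) is the divergence for the Riemannian density, tr_g g
  = n, and tr_g (v tensor v) = f. The strict inequality (n - 1) \<sigma> < 0 is where n \<ge> 2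
  enters. On a circle a field of constant nonzero length has L_V g = 0 and v tensor v = f g, so it
  solves the equation with \<sigma> = - f/m. The main obstacle is the divergence theorem. No measure
  on M and no orientation is constructed: integrals are taken in single charts, of functions that
  vanish off a compact part of the chart domain, with weight sqrt |det g_ij|. Only first derivatives
  of the cut-off functions occur, so a partition of unity of class C1 is enough. The divergence is
  not introduced by differentiation either: \<open>divergence\<close> is n \<sigma> + f/m, and its
  agreement with the coordinate expression is used only under the integral in a chart. The maximum
  and the integral are both taken over all of M, so connectedness never enters.\<close>

text \<open>
  The change of variables theorem of the library is stated for \<open>real ^ 'n\<close> with a finite
  well-ordered index type; indexing by the standard basis transfers it to any Euclidean space.
\<close>

typedef (overloaded) 'e basis = "Basis :: 'e::euclidean_space set"
  morphisms basis_vec Abs_basis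
  using nonempty_Basis by blast

instance basis :: (euclidean_space) finite
proof
  have "range (basis_vec :: 'a basis \<Rightarrow> 'a) = Basis"
    using type_definition.Rep_range[OF type_definition_basis] .
  moreover have "inj (basis_vec :: 'a basis \<Rightarrow> 'a)"
    by (simp add: basis_vec_inject inj_on_def)
  ultimately show "finite (UNIV :: 'a basis set)"
    by (metis finite_Basis finite_imageD)
qed

text \<open>The order is pulled back along the enumeration \<open>to_nat_on UNIV\<close> of the
  basis, so well-foundedness is that of the natural numbers.\<close>

instantiation basis :: (euclidean_space) wellorder
begin

definition less_eq_basis :: "'a basis \<Rightarrow> 'a basis \<Rightarrow> bool"
  where "less_eq_basis i j \<longleftrightarrow> to_nat_on UNIV i \<le> to_nat_on UNIV j"

definition less_basis :: "'a basis \<Rightarrow> 'a basis \<Rightarrow> bool"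
  where "less_basis i j \<longleftrightarrow> to_nat_on UNIV i < to_nat_on UNIV j"

instance
proof
  fix x y z :: "'a basis"
  have c: "countable (UNIV :: 'a basis set)"
    by (simp add: countable_finite)
  show "(x < y) = (x \<le> y \<and> \<not> y \<le> x)"
    unfolding less_eq_basis_def less_basis_def by linarith
  show "x \<le> x" "x \<le> y \<or> y \<le> x"
    unfolding less_eq_basis_def by linarith+
  show "x \<le> z" if "x \<le> y" "y \<le> z"
    using that unfolding less_eq_basis_def by linarith
  show "x = y" if "x \<le> y" "y \<le> x"
    using that to_nat_on_inj[OF c UNIV_I UNIV_I, of x y] unfolding less_eq_basis_def by linarith
next
  fix P :: "'a basis \<Rightarrow> bool" and a
  assume step: "\<And>x. (\<And>y. y < x \<Longrightarrow> P y) \<Longrightarrow> P x"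
  show "P a"
  proof (induction "to_nat_on UNIV a" arbitrary: a rule: less_induct)
    case less
    show ?case
    proof (rule step)
      fix y assume "y < a"
      then show "P y" unfolding less_basis_def by (rule less)
    qed
  qed
qed

end

lemma range_basis_vec: "range (basis_vec :: 'e::euclidean_space basis \<Rightarrow> 'e) = Basis"
  using type_definition.Rep_range[OF type_definition_basis] .

lemma inj_basis_vec: "inj basis_vec"
  by (simp add: basis_vec_inject inj_on_def)

lemma basis_vec_in_Basis [simp]: "basis_vec i \<in> Basis"
  by (rule basis_vec)

lemma sum_Basis_eq: "(\<Sum>b\<in>(Basis::'e::euclidean_space set). f b) = (\<Sum>i\<in>UNIV. f (basis_vec i))"
  unfolding range_basis_vec[symmetric] by (simp add: sum.reindex[OF inj_basis_vec])

lemma prod_Basis_eq: "(\<Prod>b\<in>(Basis::'e::euclidean_space set). f b) = (\<Prod>i\<in>UNIV. f (basis_vec i))"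
  unfolding range_basis_vec[symmetric] by (simp add: prod.reindex[OF inj_basis_vec])

lemma card_basis: "CARD('e::euclidean_space basis) = DIM('e)"
  by (metis card_image inj_basis_vec range_basis_vec)

lemma inner_basis_vec: "basis_vec i \<bullet> basis_vec j = (if i = j then 1 else 0)"
  by (simp add: inner_Basis basis_vec_inject)

definition to_vec :: "'e::euclidean_space \<Rightarrow> real ^ 'e basis"
  where "to_vec x = (\<chi> i. x \<bullet> basis_vec i)"

definition of_vec :: "real ^ 'e basis \<Rightarrow> 'e::euclidean_space"
  where "of_vec y = (\<Sum>i\<in>UNIV. (y $ i) *\<^sub>R basis_vec i)"

lemma of_vec_to_vec [simp]: "of_vec (to_vec x) = x"
  unfolding of_vec_def to_vec_def using euclidean_representation[of x] by (simp add: sum_Basis_eq)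

lemma to_vec_of_vec [simp]: "to_vec (of_vec y) = y"
  unfolding of_vec_def to_vec_def
  by (simp add: vec_eq_iff inner_sum_left inner_basis_vec if_distrib cong: if_cong)

lemma linear_to_vec: "linear to_vec"
  by (rule linearI) (simp_all add: to_vec_def vec_eq_iff inner_add_left)

lemma linear_of_vec: "linear of_vec"
  by (rule linearI) (simp_all add: of_vec_def scaleR_add_left sum.distrib scaleR_sum_right)

lemma bounded_linear_to_vec: "bounded_linear to_vec"
  using linear_to_vec by (simp add: linear_conv_bounded_linear)

lemma bounded_linear_of_vec: "bounded_linear of_vec"
  using linear_of_vec by (simp add: linear_conv_bounded_linear)

lemma of_vec_axis: "of_vec (axis i 1) = basis_vec i"
  unfolding of_vec_def axis_def by (simp add: if_distrib[of "\<lambda>t. t *\<^sub>R _"] cong: if_cong)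

lemma to_vec_image: "to_vec ` S = of_vec -` S"
  by (metis (no_types, opaque_lifting) bij_vimage_eq_inv_image image_cong bijI' inv_equality of_vec_to_vec to_vec_of_vec)

lemma measurable_of_vec [measurable]: "of_vec \<in> borel_measurable borel"
  using bounded_linear_of_vec
  by (intro borel_measurable_continuous_onI linear_continuous_on)

text \<open>Lebesgue measure is determined by its values on boxes, and the preimage of a box under
  \<open>of_vec\<close> is the box with the same coordinates of its corners, hence the same side
  lengths.\<close>

lemma distr_of_vec: "distr lborel borel (of_vec :: real ^ 'e::euclidean_space basis \<Rightarrow> 'e) = lborel"
proof (rule lborel_eqI[symmetric])
  fix l u :: 'e
  assume "\<And>b. b \<in> Basis \<Longrightarrow> l \<bullet> b \<le> u \<bullet> b"
  then have le: "l \<bullet> basis_vec i \<le> u \<bullet> basis_vec i" for i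
    by simp
  have "of_vec -` box l u = box (to_vec l) (to_vec u)"
  proof -
    have "of_vec y \<in> box l u \<longleftrightarrow> y \<in> box (to_vec l) (to_vec u)" for y
    proof -
      obtain x where y: "y = to_vec x"
        by (metis to_vec_of_vec)
      show ?thesis
        unfolding y of_vec_to_vec mem_box_cart mem_box range_basis_vec[symmetric]
        by (simp add: to_vec_def)
    qed
    then show ?thesis by auto
  qed
  then have "emeasure (distr lborel borel of_vec) (box l u) = emeasure lborel (box (to_vec l) (to_vec u))"
    by (subst emeasure_distr) auto
  also have "\<dots> = (\<Prod>b\<in>Basis. (to_vec u - to_vec l) \<bullet> b)"
    using le by (subst emeasure_lborel_box) (auto simp: Basis_vec_def cart_eq_inner_axis[symmetric] to_vec_def)
  also have "(\<Prod>b\<in>Basis. (to_vec u - to_vec l) \<bullet> b) = (\<Prod>i\<in>UNIV. (to_vec u - to_vec l) $ i)"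
    unfolding Basis_vec_def
    by (simp add: prod.reindex inj_on_def axis_eq_axis cart_eq_inner_axis UNION_singleton_eq_range)
  also have "\<dots> = (\<Prod>b\<in>Basis. (u - l) \<bullet> b)"
    by (simp add: prod_Basis_eq to_vec_def inner_diff_left)
  finally show "emeasure (distr lborel borel of_vec) (box l u) = (\<Prod>b\<in>Basis. (u - l) \<bullet> b)" .
qed auto

text \<open>The equivalence about integrability together with a value \<open>b\<close> has the shape
  of the change of variables theorem, so it can be chained on both sides of it. Continuity on an
  open set makes the extension by zero Borel measurable, and integrals for \<open>lebesgue\<close>
  and \<open>lborel\<close> then agree.\<close>

lemma absolutely_integrable_of_vec:
  fixes f :: "'e::euclidean_space \<Rightarrow> real"
  assumes S: "open S" and f: "continuous_on S f"
  shows "f absolutely_integrable_on S \<and> integral S f = b \<longleftrightarrow>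
    (f \<circ> of_vec) absolutely_integrable_on (to_vec ` S) \<and> integral (to_vec ` S) (f \<circ> of_vec) = b"
proof -
  define F where "F x = indicator S x * f x" for x
  have F: "F \<in> borel_measurable borel"
    using borel_measurable_continuous_on_indicator[OF _ f] S unfolding F_def by simp
  have Fv: "F (of_vec y) = indicator (to_vec ` S) y * (f \<circ> of_vec) y" for y
    unfolding F_def to_vec_image by (simp add: indicator_def)
  have m: "(\<lambda>y. F (of_vec y)) \<in> borel_measurable borel"
    using F by measurable
  have 1: "f absolutely_integrable_on S \<longleftrightarrow> integrable lborel F"
    using F by (simp add: set_integrable_def F_def[abs_def] integrable_completion)
  have 2: "(f \<circ> of_vec) absolutely_integrable_on (to_vec ` S) \<longleftrightarrow> integrable lborel (\<lambda>y. F (of_vec y))"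
    using m unfolding Fv by (simp add: set_integrable_def integrable_completion)
  have 3: "integrable lborel F \<longleftrightarrow> integrable lborel (\<lambda>y. F (of_vec y))"
    by (subst distr_of_vec[symmetric]) (simp add: integrable_distr_eq F)
  have 4: "integral\<^sup>L lborel F = (\<integral>y. F (of_vec y) \<partial>lborel)"
    by (subst distr_of_vec[symmetric]) (simp add: integral_distr F)
  have 5: "integral S f = integral\<^sup>L lborel F" if "f absolutely_integrable_on S"
  proof -
    have "integral S f = (\<integral>x. F x \<partial>lebesgue)"
      using set_lebesgue_integral_eq_integral(2)[OF that] by (simp add: set_lebesgue_integral_def F_def)
    then show ?thesis using F by (simp add: integral_completion)
  qed
  have 6: "integral (to_vec ` S) (f \<circ> of_vec) = (\<integral>y. F (of_vec y) \<partial>lborel)"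
    if "(f \<circ> of_vec) absolutely_integrable_on (to_vec ` S)"
  proof -
    have "integral (to_vec ` S) (f \<circ> of_vec) = (\<integral>x. F (of_vec x) \<partial>lebesgue)"
      using set_lebesgue_integral_eq_integral(2)[OF that] by (simp add: set_lebesgue_integral_def Fv)
    then show ?thesis using m by (simp add: integral_completion)
  qed
  show ?thesis
    using 1 2 3 4 5 6 by metis
qed

definition matrix_of :: "('e::euclidean_space \<Rightarrow> 'e) \<Rightarrow> real ^ 'e basis ^ 'e basis"
  where "matrix_of f = (\<chi> i j. f (basis_vec j) \<bullet> basis_vec i)"

lemma matrix_of_eq: "matrix_of f = matrix (to_vec \<circ> f \<circ> of_vec)"
  by (simp add: matrix_of_def matrix_def of_vec_axis to_vec_def)

theorem absolutely_integrable_change_of_variables_euclidean: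
  fixes f :: "'e::euclidean_space \<Rightarrow> real" and T :: "'e \<Rightarrow> 'e"
  assumes S: "open S" and TS: "open (T ` S)"
    and T: "\<And>x. x \<in> S \<Longrightarrow> (T has_derivative T' x) (at x)"
    and T': "continuous_on S (\<lambda>x. det (matrix_of (T' x)))"
    and inj: "inj_on T S" and f: "continuous_on (T ` S) f"
  shows "(\<lambda>x. \<bar>det (matrix_of (T' x))\<bar> * f (T x)) absolutely_integrable_on S \<and>
      integral S (\<lambda>x. \<bar>det (matrix_of (T' x))\<bar> * f (T x)) = b \<longleftrightarrow>
    f absolutely_integrable_on (T ` S) \<and> integral (T ` S) f = b"
proof -
  let ?T = "to_vec \<circ> T \<circ> of_vec" and ?S = "to_vec ` S"
  let ?T' = "\<lambda>y. to_vec \<circ> T' (of_vec y) \<circ> of_vec"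
  have im: "to_vec ` T ` S = ?T ` ?S"
    by (simp add: image_image)
  have lv: "?S \<in> sets lebesgue"
  proof -
    have "open ?S"
      unfolding to_vec_image using S bounded_linear_of_vec
      by (intro open_vimage linear_continuous_on)
    then show ?thesis by simp
  qed
  have cT: "continuous_on S T"
    using T by (meson continuous_at_imp_continuous_on has_derivative_continuous)
  have der: "(?T has_derivative ?T' y) (at y within ?S)" if "y \<in> ?S" for y
  proof -
    have "of_vec y \<in> S" using that unfolding to_vec_image by simp
    then have "(?T has_derivative ?T' y) (at y)"
      by (intro diff_chain_at bounded_linear_imp_has_derivative bounded_linear_of_vec bounded_linear_to_vec T)
    then show ?thesis by (rule has_derivative_at_withinI)
  qed
  have injv: "inj_on ?T ?S"
    using inj by (auto simp: inj_on_def) (metis of_vec_to_vec)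
  let ?D = "\<lambda>x. \<bar>det (matrix_of (T' x))\<bar> * f (T x)"
  \<comment> \<open>The theorem applied here has vector-valued integrands; the real integrand enters
    it as a function into \<open>real^1\<close> through \<open>vec\<close>.\<close>
  have "(\<lambda>y. \<bar>det (matrix (?T' y))\<bar> * (f \<circ> of_vec) (?T y)) absolutely_integrable_on ?S \<and>
      integral ?S (\<lambda>y. \<bar>det (matrix (?T' y))\<bar> * (f \<circ> of_vec) (?T y)) = b
    \<longleftrightarrow> (f \<circ> of_vec) absolutely_integrable_on (?T ` ?S) \<and> integral (?T ` ?S) (f \<circ> of_vec) = b"
    using has_absolute_integral_change_of_variables[OF lv der injv, of "\<lambda>y. vec ((f \<circ> of_vec) y) :: real^1" "vec b"]
    unfolding absolutely_integrable_on_1_iff integral_on_1_eq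
    by (simp add: vec_eq_iff comp_def)
  moreover have "(\<lambda>y. \<bar>det (matrix (?T' y))\<bar> * (f \<circ> of_vec) (?T y)) = ?D \<circ> of_vec"
    by (simp add: fun_eq_iff matrix_of_eq)
  moreover have "continuous_on S ?D"
    by (intro continuous_intros T' continuous_on_compose2[OF f cT]) auto
  ultimately show ?thesis
    using absolutely_integrable_of_vec[OF S, of ?D b] absolutely_integrable_of_vec[OF TS f, of b]
    unfolding im by (simp add: comp_def)
qed

section \<open>Continuously differentiable functions\<close>

abbreviation C1_on :: "'a::euclidean_space set \<Rightarrow> ('a \<Rightarrow> 'b::real_normed_vector) \<Rightarrow> bool"
  where "C1_on \<equiv> Ck_on (Suc 0)"

abbreviation dir_deriv :: "('a::euclidean_space \<Rightarrow> 'b::real_normed_vector) \<Rightarrow> 'a \<Rightarrow> 'a \<Rightarrow> 'b"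
  where "dir_deriv f x \<equiv> frechet_derivative f (at x)"

lemma C1_onD:
  assumes "C1_on S f"
  shows C1_on_has_derivative: "x \<in> S \<Longrightarrow> (f has_derivative dir_deriv f x) (at x)"
    and C1_on_continuous_deriv: "continuous_on S (\<lambda>x. dir_deriv f x u)"
    and C1_on_continuous: "continuous_on S f"
    and C1_on_differentiable: "x \<in> S \<Longrightarrow> f differentiable (at x)"
proof -
  show d: "f differentiable (at x)" if "x \<in> S" for x
    using assms that by simp
  show "(f has_derivative dir_deriv f x) (at x)" if "x \<in> S"
    using d[OF that] frechet_derivative_works by blast
  show "continuous_on S (\<lambda>x. dir_deriv f x u)"
    using assms by simp
  show "continuous_on S f"
    using d differentiable_imp_continuous_within by (blast intro: continuous_at_imp_continuous_on)
qed

lemma C1_onI: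
  assumes "\<And>x. x \<in> S \<Longrightarrow> (f has_derivative f' x) (at x)"
    and "\<And>u. continuous_on S (\<lambda>x. f' x u)"
  shows "C1_on S f"
proof -
  have "dir_deriv f x = f' x" if "x \<in> S" for x
    using assms(1)[OF that] by (metis frechet_derivative_at)
  then have "continuous_on S (\<lambda>x. dir_deriv f x u)" for u
    using assms(2)[of u] by (simp cong: continuous_on_cong)
  then show ?thesis
    using assms(1) by (auto simp: differentiable_def)
qed

lemma C1_on_Un:
  assumes "C1_on S f" "C1_on T f" "open S" "open T"
  shows "C1_on (S \<union> T) f"
  using assms by (auto intro: continuous_on_open_Un)

declare Ck_on.simps [simp del]

lemma dir_deriv_cong:
  assumes "open S" "x \<in> S" "\<And>y. y \<in> S \<Longrightarrow> f y = g y"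
  shows "dir_deriv f x = dir_deriv g x"
proof -
  have "(f has_derivative F) (at x) \<longleftrightarrow> (g has_derivative F) (at x)" for F
    using assms by (metis has_derivative_transform_within_open)
  then show ?thesis unfolding frechet_derivative_def by simp
qed

lemma C1_on_cong:
  assumes "open S" "\<And>y. y \<in> S \<Longrightarrow> f y = g y" and g: "C1_on S g"
  shows "C1_on S f"
proof (rule C1_onI)
  fix x assume "x \<in> S"
  then show "(f has_derivative dir_deriv g x) (at x)"
    using C1_on_has_derivative[OF g] assms(1,2) by (metis has_derivative_transform_within_open)
qed (rule C1_on_continuous_deriv[OF g])

lemma smooth_on_imp_C1_on: "smooth_on S f \<Longrightarrow> C1_on S f"
  unfolding smooth_on_def by blast

lemma C1_on_const: "C1_on S (\<lambda>x. c)"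
  by (rule C1_onI[where f'="\<lambda>_ _. 0"]) auto

lemma C1_on_mult:
  fixes f g :: "'a::euclidean_space \<Rightarrow> real"
  assumes f: "C1_on S f" and g: "C1_on S g"
  shows "C1_on S (\<lambda>x. f x * g x)"
proof (rule C1_onI)
  show "((\<lambda>x. f x * g x) has_derivative (\<lambda>u. f x * dir_deriv g x u + dir_deriv f x u * g x)) (at x)"
    if "x \<in> S" for x
    by (intro has_derivative_mult C1_on_has_derivative[OF f that] C1_on_has_derivative[OF g that])
qed (intro continuous_intros C1_on_continuous[OF f] C1_on_continuous[OF g]
    C1_on_continuous_deriv[OF f] C1_on_continuous_deriv[OF g])

lemma C1_on_sum:
  assumes "\<And>i. i \<in> I \<Longrightarrow> C1_on S (f i)"
  shows "C1_on S (\<lambda>x. \<Sum>i\<in>I. f i x)"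
proof (rule C1_onI)
  show "((\<lambda>x. \<Sum>i\<in>I. f i x) has_derivative (\<lambda>u. \<Sum>i\<in>I. dir_deriv (f i) x u)) (at x)"
    if "x \<in> S" for x
    using that by (intro has_derivative_sum C1_on_has_derivative[OF assms])
qed (intro continuous_intros C1_on_continuous_deriv[OF assms])

lemma C1_on_prod:
  fixes f :: "'i \<Rightarrow> 'a::euclidean_space \<Rightarrow> real"
  assumes "finite I" "\<And>i. i \<in> I \<Longrightarrow> C1_on S (f i)"
  shows "C1_on S (\<lambda>x. \<Prod>i\<in>I. f i x)"
  using assms by (induction I rule: finite_induct) (auto simp: C1_on_const C1_on_mult)

lemma C1_on_inner:
  fixes f :: "'a::euclidean_space \<Rightarrow> 'b::real_inner"
  assumes f: "C1_on S f"
  shows "C1_on S (\<lambda>x. f x \<bullet> b)"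
proof (rule C1_onI)
  show "((\<lambda>x. f x \<bullet> b) has_derivative (\<lambda>u. dir_deriv f x u \<bullet> b)) (at x)" if "x \<in> S" for x
    by (intro has_derivative_inner_left C1_on_has_derivative[OF f that])
qed (intro continuous_intros C1_on_continuous_deriv[OF f])

lemma C1_on_compose:
  fixes f :: "'b::euclidean_space \<Rightarrow> 'c::real_normed_vector" and T :: "'a::euclidean_space \<Rightarrow> 'b"
  assumes f: "C1_on U f" and T: "C1_on S T" and im: "T ` S \<subseteq> U"
  shows "C1_on S (\<lambda>x. f (T x))"
proof (rule C1_onI)
  fix x assume x: "x \<in> S"
  have lin: "linear (dir_deriv f (T x))"
    using C1_on_has_derivative[OF f, of "T x"] x im has_derivative_linear by blast
  have "((f \<circ> T) has_derivative dir_deriv f (T x) \<circ> dir_deriv T x) (at x)"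
    using x im by (intro diff_chain_at C1_on_has_derivative[OF f] C1_on_has_derivative[OF T]) auto
  \<comment> \<open>\<open>C1_on\<close> gives continuity of derivatives in fixed directions only,
    whereas \<open>dir_deriv T x u\<close> moves with \<open>x\<close>. Expanding it in the basis
    leaves the fixed directions \<open>b\<close>.\<close>
  moreover have "dir_deriv f (T x) \<circ> dir_deriv T x = (\<lambda>u. \<Sum>b\<in>Basis. (dir_deriv T x u \<bullet> b) *\<^sub>R dir_deriv f (T x) b)"
  proof
    fix u
    have "dir_deriv f (T x) (dir_deriv T x u) = dir_deriv f (T x) (\<Sum>b\<in>Basis. (dir_deriv T x u \<bullet> b) *\<^sub>R b)"
      by (simp add: euclidean_representation)
    also have "\<dots> = (\<Sum>b\<in>Basis. (dir_deriv T x u \<bullet> b) *\<^sub>R dir_deriv f (T x) b)"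
      using lin by (simp add: linear_sum linear_scale)
    finally show "(dir_deriv f (T x) \<circ> dir_deriv T x) u = \<dots>" by simp
  qed
  ultimately show "((\<lambda>x. f (T x)) has_derivative (\<lambda>u. \<Sum>b\<in>Basis. (dir_deriv T x u \<bullet> b) *\<^sub>R dir_deriv f (T x) b)) (at x)"
    by (simp add: comp_def)
next
  fix u
  show "continuous_on S (\<lambda>x. \<Sum>b\<in>Basis. (dir_deriv T x u \<bullet> b) *\<^sub>R dir_deriv f (T x) b)"
    by (intro continuous_intros C1_on_continuous_deriv[OF T]
        continuous_on_compose2[OF C1_on_continuous_deriv[OF f] C1_on_continuous[OF T] im])
qed

lemma C1_on_field_derivative:
  fixes f f' :: "real \<Rightarrow> real"
  assumes "\<And>x. x \<in> S \<Longrightarrow> (f has_real_derivative f' x) (at x)" "continuous_on S f'"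
  shows "C1_on S f"
  using assms
  by (intro C1_onI[where f'="\<lambda>x u. f' x * u"]) (auto simp: has_field_derivative_def intro!: continuous_intros)

lemma C1_on_inverse:
  fixes f :: "'a::euclidean_space \<Rightarrow> real"
  assumes "C1_on S f" "\<And>x. x \<in> S \<Longrightarrow> f x \<noteq> 0"
  shows "C1_on S (\<lambda>x. inverse (f x))"
proof (rule C1_on_compose[OF _ assms(1)])
  show "C1_on (- {0}) (inverse :: real \<Rightarrow> real)"
    by (rule C1_on_field_derivative) (auto intro!: derivative_eq_intros continuous_intros)
qed (use assms in auto)

lemma C1_on_det:
  fixes A :: "'a::euclidean_space \<Rightarrow> real ^ 'n ^ 'n"
  assumes "\<And>i j. C1_on S (\<lambda>x. A x $ i $ j)"
  shows "C1_on S (\<lambda>x. det (A x))"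
  unfolding det_def by (intro C1_on_sum C1_on_mult C1_on_const C1_on_prod finite assms)

text \<open>Differentiate the Leibniz formula at the identity matrix. A permutation other than
  \<open>id\<close> moves at least two indices, so after one factor is differentiated another
  off-diagonal entry 0 remains; only \<open>id\<close> contributes, and it contributes the
  trace.\<close>

lemma has_derivative_det_mat_1:
  fixes A :: "'a::real_normed_vector \<Rightarrow> real ^ 'n ^ 'n"
  assumes A: "\<And>i j. ((\<lambda>x. A x $ i $ j) has_derivative (\<lambda>h. A' h $ i $ j)) (at x)"
    and Ax: "A x = mat 1"
  shows "((\<lambda>x. det (A x)) has_derivative (\<lambda>h. trace (A' h))) (at x)"
proof -
  let ?P = "{p. p permutes (UNIV :: 'n set)}"
  have "((\<lambda>x. det (A x)) has_derivative
      (\<lambda>h. \<Sum>p\<in>?P. of_int (sign p) * (\<Sum>i\<in>UNIV. A' h $ i $ p i * (\<Prod>j\<in>UNIV - {i}. A x $ j $ p j)))) (at x)"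
    unfolding det_def by (intro has_derivative_sum has_derivative_mult_right has_derivative_prod A)
  moreover have "(\<Sum>i\<in>UNIV. A' h $ i $ p i * (\<Prod>j\<in>UNIV - {i}. A x $ j $ p j)) = (if p = id then trace (A' h) else 0)"
    if "p \<in> ?P" for p h
  proof (cases "p = id")
    case True
    then show ?thesis by (simp add: Ax mat_def trace_def)
  next
    case False
    have z: "(\<Prod>j\<in>UNIV - {i}. A x $ j $ p j) = 0" for i
    proof -
      have "\<exists>j. j \<noteq> i \<and> p j \<noteq> j"
      proof (rule ccontr)
        assume *: "\<not> (\<exists>j. j \<noteq> i \<and> p j \<noteq> j)"
        have "p i = i"
          using that * by (metis mem_Collect_eq permutes_univ)
        with * have "p j = j" for j by metis
        then have "p = id" by auto
        with False show False ..
      qed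
      then obtain j where "j \<noteq> i" "p j \<noteq> j" by blast
      then show ?thesis by (intro prod_zero) (auto simp: Ax mat_def intro!: bexI[of _ j])
    qed
    show ?thesis using False unfolding z by simp
  qed
  then have "(\<Sum>p\<in>?P. of_int (sign p) * (\<Sum>i\<in>UNIV. A' h $ i $ p i * (\<Prod>j\<in>UNIV - {i}. A x $ j $ p j)))
      = (\<Sum>p\<in>?P. if p = id then trace (A' h) else 0)" for h
    by (intro sum.cong) auto
  then have "(\<Sum>p\<in>?P. of_int (sign p) * (\<Sum>i\<in>UNIV. A' h $ i $ p i * (\<Prod>j\<in>UNIV - {i}. A x $ j $ p j))) = trace (A' h)" for h
    by (simp add: permutes_id)
  ultimately show ?thesis by simp
qed

text \<open>Jacobi's formula: multiplication by the constant inverse \<open>B\<close> moves the base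
  point to the identity matrix.\<close>

lemma has_derivative_det:
  fixes A :: "'a::real_normed_vector \<Rightarrow> real ^ 'n ^ 'n"
  assumes A: "\<And>i j. ((\<lambda>x. A x $ i $ j) has_derivative (\<lambda>h. A' h $ i $ j)) (at x)"
    and BA: "B ** A x = mat 1"
  shows "((\<lambda>x. det (A x)) has_derivative (\<lambda>h. det (A x) * trace (B ** A' h))) (at x)"
proof -
  have "((\<lambda>y. det (B ** A y)) has_derivative (\<lambda>h. trace (B ** A' h))) (at x)"
    using BA by (intro has_derivative_det_mat_1)
      (auto simp: matrix_matrix_mult_def intro!: has_derivative_sum has_derivative_mult_right A)
  then have "((\<lambda>y. det (A x) * det (B ** A y)) has_derivative (\<lambda>h. det (A x) * trace (B ** A' h))) (at x)"
    by (rule has_derivative_mult_right)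
  moreover have "det (A x) * det (B ** A y) = det (A y)" for y
    using BA by (metis det_I det_mul mult.assoc mult.commute mult_1)
  ultimately show ?thesis by simp
qed

section \<open>Integrals of derivatives of compactly supported functions\<close>

text \<open>Translation invariance gives every difference quotient of \<open>f\<close> integral 0,
  and dominated convergence passes this on to the derivative. This treats an arbitrary direction
  \<open>u\<close> without iterated integrals.\<close>

lemma integral_dir_deriv_eq_0:
  fixes f :: "'a::euclidean_space \<Rightarrow> real"
  assumes f: "C1_on UNIV f" and K: "compact K" and zero: "\<And>x. x \<notin> K \<Longrightarrow> f x = 0"
  shows "integral UNIV (\<lambda>x. dir_deriv f x u) = 0"
proof -
  let ?f' = "\<lambda>x. dir_deriv f x u"
  have cf: "continuous_on UNIV f" and cf': "continuous_on UNIV ?f'"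
    using C1_on_continuous[OF f] C1_on_continuous_deriv[OF f] by auto
  have zero': "?f' x = 0" if "x \<notin> K" for x
  proof -
    have "dir_deriv f x = dir_deriv (\<lambda>_. 0) x"
      using K zero that by (intro dir_deriv_cong[of "-K"]) (auto simp: compact_imp_closed open_Compl)
    then show ?thesis by simp
  qed
  obtain R where R: "\<And>x. x \<in> K \<Longrightarrow> norm x \<le> R"
    using compact_imp_bounded[OF K] unfolding bounded_iff by blast
  have "compact (?f' ` K)"
    using K cf' by (meson compact_continuous_image continuous_on_subset subset_UNIV)
  then obtain B0 where B0: "\<And>x. x \<in> K \<Longrightarrow> \<bar>?f' x\<bar> \<le> B0"
    using compact_imp_bounded[of "?f' ` K"] unfolding bounded_iff by auto
  \<comment> \<open>The maximum with 0 makes the bound valid off \<open>K\<close> as well, even if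
    \<open>K\<close> is empty and \<open>B0\<close> is negative.\<close>
  define B where "B = max B0 0"
  have B: "\<bar>?f' x\<bar> \<le> B" for x
    using B0[of x] zero'[of x] unfolding B_def by fastforce
  \<comment> \<open>The difference quotient with step 1/(n+1), which is at most 1: this bounds how
    far the supports of the quotients spread beyond \<open>K\<close>.\<close>
  let ?s = "\<lambda>n x. real (Suc n) * (f (x + inverse (real (Suc n)) *\<^sub>R u) - f x)"
  have line: "((\<lambda>t. f (x + t *\<^sub>R u)) has_real_derivative ?f' (x + t *\<^sub>R u)) (at t)" for x t
  proof -
    have d: "(f has_derivative dir_deriv f (x + t *\<^sub>R u)) (at (x + t *\<^sub>R u))"
      using C1_on_has_derivative[OF f] by blast
    have "((\<lambda>t. f (x + t *\<^sub>R u)) has_derivative (\<lambda>s. dir_deriv f (x + t *\<^sub>R u) (s *\<^sub>R u))) (at t)"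
      by (rule has_derivative_compose[where g=f and f="\<lambda>t. x + t *\<^sub>R u", OF _ d]) (auto intro!: derivative_eq_intros)
    then show ?thesis
      using linear_scale[OF has_derivative_linear[OF d]]
      by (simp add: has_field_derivative_def mult.commute[of _ "?f' _"])
  qed
  have int: "integrable lborel f"
  proof -
    have "(\<lambda>x. indicator K x *\<^sub>R f x) = f"
      using zero by (auto simp: indicator_def fun_eq_iff)
    then show ?thesis
      using borel_integrable_compact[OF K continuous_on_subset[OF cf]] by simp
  qed
  have int_s: "integral\<^sup>L lborel (?s n) = 0" for n
  proof -
    let ?v = "inverse (real (Suc n)) *\<^sub>R u"
    have sh: "integrable lborel (\<lambda>x. f (?v + x))" "(\<integral>x. f (?v + x) \<partial>lborel) = integral\<^sup>L lborel f"
      using int borel_measurable_continuous_onI[OF cf] lborel_distr_plus[of ?v]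
        integrable_distr_eq[of "(+) ?v" lborel borel f] integral_distr[of "(+) ?v" lborel borel f]
      by simp_all
    have "(\<lambda>x. f (?v + x)) = (\<lambda>x. f (x + ?v))"
      by (simp add: add.commute)
    then show ?thesis
      using int sh by (simp del: of_nat_Suc)
  qed
  have "(\<lambda>n. integral\<^sup>L lborel (?s n)) \<longlonglongrightarrow> integral\<^sup>L lborel ?f'"
  proof (rule integral_dominated_convergence)
    \<comment> \<open>The dominating function: by the mean value theorem each quotient is a value of
      the derivative, hence bounded by \<open>B\<close>, and it vanishes where both \<open>x\<close>
      and its translate have norm above \<open>R\<close>.\<close>
    show "integrable lborel (\<lambda>x. indicator (cball 0 (R + norm u)) x * B :: real)"
      using emeasure_lborel_cball_finite[of 0 "R + norm u"]
      by (intro integrable_mult_left integrable_real_indicator) simp_all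
    show "AE x in lborel. (\<lambda>n. ?s n x) \<longlonglongrightarrow> ?f' x"
    proof (rule AE_I2)
      fix x
      have "((\<lambda>h. (f (x + h *\<^sub>R u) - f x) / h) \<longlongrightarrow> ?f' x) (at 0)"
        using line[of x 0] by (simp add: has_field_derivative_iff)
      moreover have "filterlim (\<lambda>n. inverse (real (Suc n))) (at 0) sequentially"
        unfolding filterlim_at using LIMSEQ_inverse_real_of_nat by auto
      ultimately have "(\<lambda>n. (f (x + inverse (real (Suc n)) *\<^sub>R u) - f x) / inverse (real (Suc n))) \<longlonglongrightarrow> ?f' x"
        by (rule filterlim_compose)
      then show "(\<lambda>n. ?s n x) \<longlonglongrightarrow> ?f' x"
        by (simp add: divide_inverse mult.commute del: of_nat_Suc)
    qed
    show "AE x in lborel. norm (?s n x) \<le> indicator (cball 0 (R + norm u)) x * B" for n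
    proof (rule AE_I2)
      fix x
      let ?h = "inverse (real (Suc n))"
      have h: "0 < ?h" "?h \<le> 1" by (auto simp: field_simps)
      show "norm (?s n x) \<le> indicator (cball 0 (R + norm u)) x * B"
      proof (cases "x \<in> cball 0 (R + norm u)")
        case True
        obtain z where "0 < z" "z < ?h" and z: "f (x + ?h *\<^sub>R u) - f (x + 0 *\<^sub>R u) = (?h - 0) * ?f' (x + z *\<^sub>R u)"
          using MVT2[OF h(1), of "\<lambda>t. f (x + t *\<^sub>R u)" "\<lambda>t. ?f' (x + t *\<^sub>R u)"] line by blast
        then have "?s n x = ?f' (x + z *\<^sub>R u)" by (simp del: of_nat_Suc)
        then show ?thesis using True B by simp
      next
        case False
        then have "norm x > R + norm u" by simp
        moreover have "norm (?h *\<^sub>R u) \<le> norm u" using h by (simp add: mult_left_le_one_le del: of_nat_Suc)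
        moreover have "norm u \<ge> 0" by simp
        ultimately have "norm x > R" "norm (x + ?h *\<^sub>R u) > R"
          using norm_triangle_ineq2[of x "- (?h *\<^sub>R u)"] unfolding norm_minus_cancel diff_minus_eq_add by linarith+
        then have "f x = 0" "f (x + ?h *\<^sub>R u) = 0"
          using R zero by (meson not_le)+
        then show ?thesis using False by simp
      qed
    qed
  qed (use cf cf' in \<open>auto intro!: borel_measurable_continuous_onI continuous_intros continuous_on_compose2[OF cf]\<close>)
  then have "integral\<^sup>L lborel ?f' = 0"
    unfolding int_s by (simp add: LIMSEQ_const_iff)
  moreover have "integrable lborel ?f'"
  proof -
    have "(\<lambda>x. indicator K x *\<^sub>R ?f' x) = ?f'"
      using zero' by (auto simp: indicator_def fun_eq_iff)
    then show ?thesis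
      using borel_integrable_compact[OF K continuous_on_subset[OF cf']] by simp
  qed
  ultimately show ?thesis
    by (simp add: integral_lborel)
qed

lemma absolutely_integrable_compact_support:
  fixes f :: "'a::euclidean_space \<Rightarrow> real"
  assumes f: "continuous_on S f" and K: "compact K" "K \<subseteq> S" and zero: "\<And>x. x \<in> S - K \<Longrightarrow> f x = 0"
  shows "f absolutely_integrable_on S"
proof -
  have "integrable lborel (\<lambda>x. indicator K x *\<^sub>R f x)"
    using borel_integrable_compact[OF K(1) continuous_on_subset[OF f K(2)]] .
  moreover have "(\<lambda>x. indicator K x *\<^sub>R f x) = (\<lambda>x. indicator S x *\<^sub>R f x)"
    using K(2) zero by (auto simp: indicator_def fun_eq_iff)
  ultimately show ?thesis
    unfolding set_integrable_def by (metis integrable_completion borel_measurable_integrable)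
qed

lemma integral_divergence_eq_0:
  fixes f :: "'a::euclidean_space \<Rightarrow> 'a \<Rightarrow> real"
  assumes f: "\<And>b. b \<in> Basis \<Longrightarrow> C1_on UNIV (f b)"
    and K: "compact K" and zero: "\<And>b x. x \<notin> K \<Longrightarrow> f b x = 0"
  shows "integral UNIV (\<lambda>x. \<Sum>b\<in>Basis. dir_deriv (f b) x b) = 0"
proof -
  have "dir_deriv (f b) x b = 0" if "x \<notin> K" for b x
  proof -
    have "dir_deriv (f b) x = dir_deriv (\<lambda>_. 0) x"
      using K zero that by (intro dir_deriv_cong[of "-K"]) (auto simp: compact_imp_closed open_Compl)
    then show ?thesis by simp
  qed
  then have "(\<lambda>x. dir_deriv (f b) x b) absolutely_integrable_on UNIV" if "b \<in> Basis" for b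
    using C1_on_continuous_deriv[OF f[OF that]] K
    by (intro absolutely_integrable_compact_support[of _ _ K]) auto
  then have "integral UNIV (\<lambda>x. \<Sum>b\<in>Basis. dir_deriv (f b) x b)
      = (\<Sum>b\<in>Basis. integral UNIV (\<lambda>x. dir_deriv (f b) x b))"
    by (intro integral_sum) (auto dest: set_lebesgue_integral_eq_integral(1))
  also have "\<dots> = 0"
    using integral_dir_deriv_eq_0[OF f K zero] by simp
  finally show ?thesis .
qed

section \<open>Bilinear forms, Gram matrices and traces\<close>

lemma bilinear_Basis_sum:
  fixes G :: "'a::euclidean_space \<Rightarrow> 'a \<Rightarrow> real"
  assumes "bilinear G"
  shows "G u w = (\<Sum>a\<in>Basis. \<Sum>b\<in>Basis. (u \<bullet> a) * (w \<bullet> b) * G a b)"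
proof -
  have l: "linear (G a)" "linear (\<lambda>a. G a w)" for a w
    using assms by (simp_all add: bilinear_def)
  have "G u w = G (\<Sum>a\<in>Basis. (u \<bullet> a) *\<^sub>R a) w"
    by (simp add: euclidean_representation)
  also have "\<dots> = (\<Sum>a\<in>Basis. (u \<bullet> a) * G a w)"
    by (simp only: linear_sum[OF l(2)] linear_scale[OF l(2)] real_scaleR_def)
  also have "\<dots> = (\<Sum>a\<in>Basis. (u \<bullet> a) * G a (\<Sum>b\<in>Basis. (w \<bullet> b) *\<^sub>R b))"
    by (simp add: euclidean_representation)
  also have "\<dots> = (\<Sum>a\<in>Basis. (u \<bullet> a) * (\<Sum>b\<in>Basis. (w \<bullet> b) * G a b))"
    by (simp only: linear_sum[OF l(1)] linear_scale[OF l(1)] real_scaleR_def)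
  finally show ?thesis
    by (simp add: sum_distrib_left mult.assoc)
qed

text \<open>Expanding in the basis turns the form into finitely many products of real functions, to
  which the ordinary product rule applies. The same expansion with \<open>v x\<close> and
  \<open>w x\<close> frozen identifies the term in which only \<open>G\<close> is differentiated.
  Both expansions hold on \<open>S\<close>, which suffices near \<open>x\<close>.\<close>

lemma has_derivative_bilinear_form:
  fixes G :: "'a::euclidean_space \<Rightarrow> 'a \<Rightarrow> 'a \<Rightarrow> real"
  assumes S: "open S" "x \<in> S"
    and bil: "\<And>y. y \<in> S \<Longrightarrow> bilinear (G y)"
    and G: "\<And>u w. (\<lambda>y. G y u w) differentiable (at x)"
    and v: "(v has_derivative v') (at x)" and w: "(w has_derivative w') (at x)"
  shows "((\<lambda>y. G y (v y) (w y)) has_derivative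
    (\<lambda>h. dir_deriv (\<lambda>y. G y (v x) (w x)) x h + G x (v' h) (w x) + G x (v x) (w' h))) (at x)"
proof -
  let ?dG = "\<lambda>a b. dir_deriv (\<lambda>y. G y a b) x"
  have G': "((\<lambda>y. G y a b) has_derivative ?dG a b) (at x)" for a b
    using G frechet_derivative_works by blast
  have "((\<lambda>y. \<Sum>a\<in>Basis. \<Sum>b\<in>Basis. (v x \<bullet> a) * (w x \<bullet> b) * G y a b) has_derivative
      (\<lambda>h. \<Sum>a\<in>Basis. \<Sum>b\<in>Basis. (v x \<bullet> a) * (w x \<bullet> b) * ?dG a b h)) (at x)"
    by (intro has_derivative_sum has_derivative_mult_right G')
  then have "((\<lambda>y. G y (v x) (w x)) has_derivative
      (\<lambda>h. \<Sum>a\<in>Basis. \<Sum>b\<in>Basis. (v x \<bullet> a) * (w x \<bullet> b) * ?dG a b h)) (at x)"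
    by (rule has_derivative_transform_within_open[OF _ S]) (rule bilinear_Basis_sum[symmetric, OF bil])
  then have dG: "?dG (v x) (w x) = (\<lambda>h. \<Sum>a\<in>Basis. \<Sum>b\<in>Basis. (v x \<bullet> a) * (w x \<bullet> b) * ?dG a b h)"
    by (rule frechet_derivative_at[symmetric])
  have "((\<lambda>y. \<Sum>a\<in>Basis. \<Sum>b\<in>Basis. (v y \<bullet> a) * (w y \<bullet> b) * G y a b) has_derivative
      (\<lambda>h. \<Sum>a\<in>Basis. \<Sum>b\<in>Basis. (v x \<bullet> a) * (w x \<bullet> b) * ?dG a b h
        + ((v x \<bullet> a) * (w' h \<bullet> b) + (v' h \<bullet> a) * (w x \<bullet> b)) * G x a b)) (at x)"
    by (intro has_derivative_sum has_derivative_mult has_derivative_inner_left G' v w)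
  then have "((\<lambda>y. G y (v y) (w y)) has_derivative
      (\<lambda>h. \<Sum>a\<in>Basis. \<Sum>b\<in>Basis. (v x \<bullet> a) * (w x \<bullet> b) * ?dG a b h
        + ((v x \<bullet> a) * (w' h \<bullet> b) + (v' h \<bullet> a) * (w x \<bullet> b)) * G x a b)) (at x)"
    by (rule has_derivative_transform_within_open[OF _ S]) (rule bilinear_Basis_sum[symmetric, OF bil])
  moreover have "(\<Sum>a\<in>Basis. \<Sum>b\<in>Basis. (v x \<bullet> a) * (w x \<bullet> b) * ?dG a b h
        + ((v x \<bullet> a) * (w' h \<bullet> b) + (v' h \<bullet> a) * (w x \<bullet> b)) * G x a b)
      = ?dG (v x) (w x) h + G x (v' h) (w x) + G x (v x) (w' h)" for h
    unfolding dG bilinear_Basis_sum[OF bil[OF S(2)], of "v' h"] bilinear_Basis_sum[OF bil[OF S(2)], of "v x" "w' h"]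
    by (simp add: sum.distrib algebra_simps)
  ultimately show ?thesis by simp
qed

text \<open>With \<open>f = h\<close> this is the transformation law of the Gram matrix under a
  change of coordinates. With the identity for one of the two maps it yields the products A^T G and
  G A of the trace computation.\<close>

lemma gram_matrix_linear:
  fixes G :: "'a::euclidean_space \<Rightarrow> 'a \<Rightarrow> real"
  assumes "bilinear G"
  shows "(\<chi> i j. G (f (basis_vec i)) (h (basis_vec j)))
    = transpose (matrix_of f) ** (\<chi> i j. G (basis_vec i) (basis_vec j)) ** matrix_of h"
proof -
  have "G (f (basis_vec i)) (h (basis_vec j)) =
      (\<Sum>l\<in>UNIV. (\<Sum>k\<in>UNIV. (f (basis_vec i) \<bullet> basis_vec k) * G (basis_vec k) (basis_vec l)) * (h (basis_vec j) \<bullet> basis_vec l))" for i j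
    unfolding bilinear_Basis_sum[OF assms, of "f (basis_vec i)"] sum_Basis_eq
    by (subst sum.swap) (simp add: sum_distrib_left sum_distrib_right mult_ac)
  then show ?thesis
    by (simp add: vec_eq_iff matrix_matrix_mult_def transpose_def matrix_of_def)
qed

lemma gram_matrix_mult:
  fixes G :: "'a::euclidean_space \<Rightarrow> 'a \<Rightarrow> real"
  assumes "bilinear G"
  shows "(\<chi> i j. G (basis_vec i) (basis_vec j)) *v y = (\<chi> i. G (basis_vec i) (of_vec y))"
proof -
  have l: "linear (G a)" for a
    using assms by (simp add: bilinear_def)
  show ?thesis
    unfolding of_vec_def linear_sum[OF l] linear_scale[OF l]
    by (simp add: matrix_vector_mult_def mult.commute)
qed

text \<open>A vector \<open>y\<close> in the kernel of the Gram matrix pairs to 0 with every basis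
  vector, hence with itself, and positivity forces it to vanish.\<close>

lemma gram_matrix_left_invertible:
  fixes G :: "'a::euclidean_space \<Rightarrow> 'a \<Rightarrow> real"
  assumes bil: "bilinear G" and pos: "\<And>u. u \<noteq> 0 \<Longrightarrow> G u u > 0"
  shows "\<exists>B. B ** (\<chi> i j. G (basis_vec i) (basis_vec j)) = mat 1"
  unfolding matrix_left_invertible_ker
proof (intro allI impI)
  fix y :: "real ^ 'a basis"
  assume "(\<chi> i j. G (basis_vec i) (basis_vec j)) *v y = 0"
  then have "G (basis_vec i) (of_vec y) = 0" for i
    unfolding gram_matrix_mult[OF bil] by (simp add: vec_eq_iff)
  moreover have l: "linear (\<lambda>a. G a (of_vec y))"
    using bil by (simp add: bilinear_def)
  have "G (of_vec y) (of_vec y) = (\<Sum>i\<in>UNIV. (y $ i) * G (basis_vec i) (of_vec y))"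
    by (subst of_vec_def) (simp add: linear_sum[OF l] linear_scale[OF l])
  ultimately have "of_vec y = 0"
    using pos[of "of_vec y"] by auto
  then show "y = 0"
    by (metis to_vec_of_vec linear_0 linear_to_vec)
qed

text \<open>In coordinates this is \<open>div V = 1/2 tr\<^sub>g (\<L>\<^sub>V g)\<close>.\<close>

lemma trace_homothetic_equation:
  fixes G :: "'a::euclidean_space \<Rightarrow> 'a \<Rightarrow> real" and H :: "real ^ 'a basis ^ 'a basis"
  assumes bil: "bilinear G" and sym: "\<And>u w. G u w = G w u"
    and inv: "B ** (\<chi> i j. G (basis_vec i) (basis_vec j)) = mat 1"
    and eq: "\<And>i j. 1/2 * (H $ i $ j + G (D (basis_vec i)) (basis_vec j) + G (basis_vec i) (D (basis_vec j)))
      - 1/m * (G v (basis_vec i) * G v (basis_vec j)) = \<sigma> * G (basis_vec i) (basis_vec j)"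
  shows "trace (B ** H) / 2 + (\<Sum>b\<in>Basis. D b \<bullet> b) = \<sigma> * DIM('a) + G v v / m"
proof -
  let ?G = "\<chi> i j. G (basis_vec i) (basis_vec j)"
  let ?W = "\<chi> i j. G v (basis_vec i) * G v (basis_vec j)"
  let ?A = "matrix_of D"
  have inv': "?G ** B = mat 1"
    using inv matrix_left_right_inverse by blast
  have id: "matrix_of (\<lambda>x::'a. x) = mat 1"
    by (simp add: matrix_of_def mat_def vec_eq_iff inner_basis_vec)
  \<comment> \<open>Solved for \<open>H\<close>, the equation can be multiplied by \<open>B\<close>
    and traced term by term; the two products with the matrix of \<open>D\<close> contribute the
    same trace.\<close>
  have H: "H = (2 * \<sigma>) *\<^sub>R ?G + (2/m) *\<^sub>R ?W - (transpose ?A ** ?G + ?G ** ?A)"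
  proof -
    have "G (D (basis_vec i)) (basis_vec j) = (transpose ?A ** ?G) $ i $ j" for i j
      using arg_cong[OF gram_matrix_linear[OF bil, of D "\<lambda>x. x"], of "\<lambda>M. M $ i $ j"] by (simp add: id)
    moreover have "G (basis_vec i) (D (basis_vec j)) = (?G ** ?A) $ i $ j" for i j
      using arg_cong[OF gram_matrix_linear[OF bil, of "\<lambda>x. x" D], of "\<lambda>M. M $ i $ j"] by (simp add: id)
    ultimately have "H $ i $ j = 2 * \<sigma> * G (basis_vec i) (basis_vec j)
        + 2 / m * (G v (basis_vec i) * G v (basis_vec j))
        - ((transpose ?A ** ?G) $ i $ j + (?G ** ?A) $ i $ j)" for i j
      using eq[of i j] by (simp add: algebra_simps)
    then show ?thesis
      by (simp add: vec_eq_iff)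
  qed
  have "trace (B ** ?G) = real DIM('a)"
    by (simp add: inv trace_I card_basis)
  moreover have "trace (B ** (transpose ?A ** ?G)) = trace ?A"
  proof -
    have "trace (B ** (transpose ?A ** ?G)) = trace (?G ** (B ** transpose ?A))"
      by (subst matrix_mul_assoc) (rule trace_mul_sym)
    moreover have "trace (transpose ?A) = trace ?A"
      by (simp add: trace_def transpose_def)
    ultimately show ?thesis
      by (simp add: matrix_mul_assoc inv')
  qed
  moreover have "trace (B ** (?G ** ?A)) = trace ?A"
    by (simp add: matrix_mul_assoc inv)
  \<comment> \<open>Applying \<open>B\<close> raises the index: it turns the covector with entries
    \<open>G v (basis_vec k)\<close> back into the coordinates of \<open>v\<close>.\<close>
  moreover have "trace (B ** ?W) = G v v"
  proof -
    have "B *v (\<chi> k. G v (basis_vec k)) = B *v (?G *v to_vec v)"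
      by (simp add: gram_matrix_mult[OF bil] sym[of v])
    then have "B *v (\<chi> k. G v (basis_vec k)) = to_vec v"
      by (simp add: matrix_vector_mul_assoc inv)
    then have "(\<Sum>k\<in>UNIV. B $ i $ k * G v (basis_vec k)) = v \<bullet> basis_vec i" for i
      by (simp add: vec_eq_iff matrix_vector_mult_def to_vec_def)
    then have "trace (B ** ?W) = (\<Sum>i\<in>UNIV. (v \<bullet> basis_vec i) * G v (basis_vec i))"
      by (simp add: trace_def matrix_matrix_mult_def mult.assoc[symmetric] sum_distrib_right[symmetric])
    also have "\<dots> = G v v"
    proof -
      have l: "linear (G v)"
        using bil by (simp add: bilinear_def)
      have "G v v = G v (of_vec (to_vec v))" by simp
      also have "\<dots> = (\<Sum>i\<in>UNIV. (v \<bullet> basis_vec i) * G v (basis_vec i))"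
        unfolding of_vec_def linear_sum[OF l] linear_scale[OF l] by (simp add: to_vec_def)
      finally show ?thesis by simp
    qed
    finally show ?thesis .
  qed
  moreover have "trace ?A = (\<Sum>b\<in>Basis. D b \<bullet> b)"
    by (simp add: trace_def matrix_of_def sum_Basis_eq)
  moreover have "trace (B ** H) = 2 * \<sigma> * trace (B ** ?G) + 2/m * trace (B ** ?W)
      - (trace (B ** (transpose ?A ** ?G)) + trace (B ** (?G ** ?A)))"
  proof -
    have lin: "linear (\<lambda>M. trace (B ** M))"
      by (rule linearI)
        (simp_all add: trace_def matrix_matrix_mult_def sum_distrib_left sum.distrib algebra_simps)
    show ?thesis
      unfolding H by (simp only: linear_diff[OF lin] linear_add[OF lin] linear_scale[OF lin] real_scaleR_def)
  qed
  ultimately show ?thesis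
    by (simp add: add_divide_distrib diff_divide_distrib)
qed

section \<open>Square root, strict positivity of integrals, and a Euclidean bump function\<close>

text \<open>One quotient covers both signs: it is 1/(2 sqrt t) for t > 0 and -1/(2 sqrt (-t)) for t
  < 0. The absolute value is that of the Gram determinant in \<open>density\<close>.\<close>

lemma has_real_derivative_sqrt_abs:
  fixes t :: real
  assumes "t \<noteq> 0"
  shows "((\<lambda>t. sqrt \<bar>t\<bar>) has_real_derivative sqrt \<bar>t\<bar> / (2 * t)) (at t)"
proof (cases "t > 0")
  case True
  then have "(sqrt has_real_derivative sqrt \<bar>t\<bar> / (2 * t)) (at t)"
    by (auto intro!: derivative_eq_intros simp: field_simps)
  then show ?thesis
    by (rule has_field_derivative_transform_within_open[where S="{0<..}"]) (use True in auto)
next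
  case False
  then have "((\<lambda>t. sqrt (- t)) has_real_derivative sqrt \<bar>t\<bar> / (2 * t)) (at t)"
    using assms by (auto intro!: derivative_eq_intros simp: field_simps)
  then show ?thesis
    by (rule has_field_derivative_transform_within_open[where S="{..<0}"]) (use False assms in auto)
qed

text \<open>By continuity \<open>f\<close> exceeds \<open>f x / 2\<close> on a nondegenerate box
  inside \<open>S\<close>, and this box alone gives a positive contribution.\<close>

lemma integral_pos_continuous:
  fixes f :: "'a::euclidean_space \<Rightarrow> real"
  assumes S: "open S" and f: "continuous_on S f" "f integrable_on S"
    and nonneg: "\<And>x. x \<in> S \<Longrightarrow> f x \<ge> 0" and x: "x \<in> S" "f x > 0"
  shows "integral S f > 0"
proof -
  have "open {y \<in> S. f y \<in> {f x / 2<..}}"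
    using continuous_open_preimage[OF f(1) S, of "{f x / 2<..}"] by (simp add: vimage_def Int_def)
  moreover have "x \<in> {y \<in> S. f y \<in> {f x / 2<..}}"
    using x by simp
  ultimately obtain a b where ab: "cbox a b \<subseteq> {y \<in> S. f y \<in> {f x / 2<..}}" "\<forall>i\<in>Basis. a \<bullet> i < b \<bullet> i"
    by (rule open_contains_cbox)
  have int: "f integrable_on cbox a b"
    using ab f(1) by (intro integrable_continuous) (auto intro: continuous_on_subset)
  have "measure lborel (cbox a b) > 0"
    using ab(2) by (simp add: content_pos_lt_eq)
  then have "0 < measure lborel (cbox a b) * (f x / 2)"
    using x by simp
  also have "\<dots> = integral (cbox a b) (\<lambda>_. f x / 2)"
    by simp
  also have "\<dots> \<le> integral (cbox a b) f"
    using ab(1) by (intro integral_le int) (auto simp: less_imp_le subset_iff)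
  also have "\<dots> \<le> integral S f"
    using ab(1) nonneg by (intro integral_subset_le int f) auto
  finally show ?thesis .
qed

text \<open>Squaring the positive part removes its corner: the derivative \<open>2 * max 0 s\<close>
  passes continuously through 0.\<close>

lemma C1_on_max_0_square: "C1_on UNIV (\<lambda>s. (max 0 s)\<^sup>2 :: real)"
proof (rule C1_on_field_derivative[where f'="\<lambda>s. 2 * max 0 s"])
  fix s :: real
  consider "s > 0" | "s < 0" | "s = 0" by linarith
  then show "((\<lambda>s. (max 0 s)\<^sup>2) has_real_derivative 2 * max 0 s) (at s)"
  proof cases
    case 1
    then have "((\<lambda>s. s\<^sup>2) has_real_derivative 2 * max 0 s) (at s)"
      by (auto intro!: derivative_eq_intros)
    then show ?thesis
      by (rule has_field_derivative_transform_within_open[where S="{0<..}"]) (use 1 in auto)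
  next
    case 2
    then have "((\<lambda>s. 0) has_real_derivative 2 * max 0 s) (at s)"
      by (auto intro!: derivative_eq_intros)
    then show ?thesis
      by (rule has_field_derivative_transform_within_open[where S="{..<0}"]) (use 2 in auto)
  next
    case 3
    have "((\<lambda>h::real. max 0 h) \<longlongrightarrow> max 0 0) (at 0)"
      by (intro tendsto_intros)
    moreover have "max 0 h = (max 0 h)\<^sup>2 / h" if "h \<noteq> 0" for h :: real
      using that by (auto simp: max_def power2_eq_square)
    ultimately have "((\<lambda>h::real. (max 0 h)\<^sup>2 / h) \<longlongrightarrow> 0) (at 0)"
      by (simp cong: LIM_cong)
    with 3 show ?thesis
      by (simp add: has_field_derivative_iff)
  qed
qed (intro continuous_intros)

text \<open>For \<open>r > 0\<close> this function is positive exactly on the open ball of radius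
  \<open>r\<close> around \<open>x0\<close>. The norm is squared to be differentiable at the
  centre.\<close>

lemma C1_on_bump:
  fixes x0 :: "'a::euclidean_space"
  shows "C1_on UNIV (\<lambda>y. (max 0 (r\<^sup>2 - (norm (y - x0))\<^sup>2))\<^sup>2)"
proof (rule C1_on_compose[OF C1_on_max_0_square])
  show "C1_on UNIV (\<lambda>y. r\<^sup>2 - (norm (y - x0))\<^sup>2)"
    unfolding power2_norm_eq_inner
    by (rule C1_onI[where f'="\<lambda>y u. - (2 * ((y - x0) \<bullet> u))"])
      (auto intro!: derivative_eq_intros continuous_intros simp: inner_commute)
qed auto

section \<open>Charts, tangent vectors and functions on a manifold\<close>

context smooth_manifold
begin

lemma chart_dom_subset: "c \<in> atlas \<Longrightarrow> chart_dom c \<subseteq> topspace X"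
  using open_dom openin_subset by blast

lemma chart_dom_topspace: "c \<in> atlas \<Longrightarrow> p \<in> chart_dom c \<Longrightarrow> p \<in> topspace X"
  using chart_dom_subset by blast

lemma inj_chart: "c \<in> atlas \<Longrightarrow> inj_on (chart_map c) (chart_dom c)"
  using homeomorphic_imp_injective_map[OF homeo] chart_dom_subset
  by (simp add: inf.absorb2)

lemma chart_inv_map [simp]: "c \<in> atlas \<Longrightarrow> p \<in> chart_dom c \<Longrightarrow> chart_inv c (chart_map c p) = p"
  by (simp add: chart_inv_def inj_chart)

lemma chart_map_inv [simp]: "x \<in> chart_image c \<Longrightarrow> chart_map c (chart_inv c x) = x"
  by (simp add: chart_inv_def chart_image_def f_inv_into_f)

lemma chart_inv_in_dom [simp]: "x \<in> chart_image c \<Longrightarrow> chart_inv c x \<in> chart_dom c"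
  by (simp add: chart_inv_def chart_image_def inv_into_into)

lemma chart_map_in_image [simp]: "p \<in> chart_dom c \<Longrightarrow> chart_map c p \<in> chart_image c"
  by (simp add: chart_image_def)

lemma open_chart_image_Int:
  assumes "c \<in> atlas" "openin X W"
  shows "open (chart_map c ` (chart_dom c \<inter> W))"
proof -
  have "openin (subtopology X (chart_dom c)) (chart_dom c \<inter> W)"
    using assms by (simp add: openin_subtopology_Int2)
  then have "openin (top_of_set (chart_image c)) (chart_map c ` (chart_dom c \<inter> W))"
    using homeomorphic_imp_open_map[OF homeo[OF assms(1)]] unfolding open_map_def by blast
  then show ?thesis
    using open_image[OF assms(1)] openin_open_trans by blast
qed

lemma openin_chart_vimage:
  assumes "c \<in> atlas" "open W"
  shows "openin X {p \<in> chart_dom c. chart_map c p \<in> W}"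
proof -
  have "openin (top_of_set (chart_image c)) (chart_image c \<inter> W)"
    using assms by (simp add: openin_open_Int)
  then have "openin (subtopology X (chart_dom c))
      {p \<in> topspace (subtopology X (chart_dom c)). chart_map c p \<in> chart_image c \<inter> W}"
    using homeomorphic_imp_continuous_map[OF homeo[OF assms(1)]] openin_continuous_map_preimage by blast
  moreover have "{p \<in> topspace (subtopology X (chart_dom c)). chart_map c p \<in> chart_image c \<inter> W}
      = {p \<in> chart_dom c. chart_map c p \<in> W}"
    using chart_dom_subset[OF assms(1)] by auto
  ultimately show ?thesis
    using open_dom[OF assms(1)] by (simp add: openin_open_subtopology)
qed

lemma continuous_map_chart_inv:
  assumes "c \<in> atlas"
  shows "continuous_map (top_of_set (chart_image c)) X (chart_inv c)"
  unfolding continuous_map_def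
proof (intro conjI allI impI)
  show "chart_inv c \<in> topspace (top_of_set (chart_image c)) \<rightarrow> topspace X"
    using chart_dom_subset[OF assms] by auto
next
  fix W assume W: "openin X W"
  have "{x \<in> chart_image c. chart_inv c x \<in> W} = chart_map c ` (chart_dom c \<inter> W)"
    using assms by (force simp: image_iff)
  then show "openin (top_of_set (chart_image c)) {x \<in> topspace (top_of_set (chart_image c)). chart_inv c x \<in> W}"
    using open_chart_image_Int[OF assms W] by (auto simp: chart_image_def intro!: open_subset)
qed

lemma compactin_chart_inv:
  assumes "c \<in> atlas" "compact K" "K \<subseteq> chart_image c"
  shows "compactin X (chart_inv c ` K)"
  using assms by (intro image_compactin[OF _ continuous_map_chart_inv]) (auto simp: compactin_subtopology)

definition overlap :: "('m, 'e) chart \<Rightarrow> ('m, 'e) chart \<Rightarrow> 'e set"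
  where "overlap c d = chart_map c ` (chart_dom c \<inter> chart_dom d)"

lemma open_overlap: "c \<in> atlas \<Longrightarrow> d \<in> atlas \<Longrightarrow> open (overlap c d)"
  unfolding overlap_def by (intro open_chart_image_Int open_dom)

lemma overlap_subset: "overlap c d \<subseteq> chart_image c"
  by (auto simp: overlap_def)

lemma overlap_iff:
  assumes "c \<in> atlas"
  shows "x \<in> overlap c d \<longleftrightarrow> x \<in> chart_image c \<and> chart_inv c x \<in> chart_dom d"
  using assms by (force simp: overlap_def image_iff)

lemma transition_chart_map [simp]:
  "c \<in> atlas \<Longrightarrow> p \<in> chart_dom c \<Longrightarrow> transition c d (chart_map c p) = chart_map d p"
  by (simp add: transition_def)

lemma transition_image:
  assumes "c \<in> atlas"
  shows "transition c d ` overlap c d = overlap d c"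
proof -
  have "transition c d ` overlap c d = chart_map d ` (chart_dom c \<inter> chart_dom d)"
    unfolding overlap_def image_image using assms by (intro image_cong) auto
  then show ?thesis
    by (simp add: overlap_def Int_commute)
qed

lemma chart_inv_transition:
  assumes "c \<in> atlas" "d \<in> atlas" "x \<in> overlap c d"
  shows "chart_inv d (transition c d x) = chart_inv c x"
  using assms by (auto simp: overlap_def)

lemma inj_transition:
  assumes "c \<in> atlas" "d \<in> atlas"
  shows "inj_on (transition c d) (overlap c d)"
proof (rule inj_onI)
  fix x y assume xy: "x \<in> overlap c d" "y \<in> overlap c d" "transition c d x = transition c d y"
  then have "chart_inv c x = chart_inv c y"
    using assms chart_inv_transition by metis
  then show "x = y"
    using xy overlap_subset by (metis chart_map_inv subsetD)
qed

lemma C1_on_transition: "c \<in> atlas \<Longrightarrow> d \<in> atlas \<Longrightarrow> C1_on (overlap c d) (transition c d)"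
  unfolding overlap_def by (intro smooth_on_imp_C1_on smooth_transition)

lemma transition_has_derivative:
  assumes "c \<in> atlas" "d \<in> atlas" "p \<in> chart_dom c" "p \<in> chart_dom d"
  shows "(transition c d has_derivative transition_deriv c d p) (at (chart_map c p))"
  unfolding transition_deriv_def using assms
  by (intro C1_on_has_derivative[OF C1_on_transition]) (auto simp: overlap_def)

lemma linear_transition_deriv:
  assumes "c \<in> atlas" "d \<in> atlas" "p \<in> chart_dom c" "p \<in> chart_dom d"
  shows "linear (transition_deriv c d p)"
  using transition_has_derivative[OF assms] has_derivative_linear by blast

text \<open>The chain rule for two coordinate expressions of one map near \<open>p\<close>. Real
  values give the chart independence of \<open>field_deriv\<close>; transition maps as
  \<open>f\<close> and \<open>h\<close> give the cocycle rule.\<close>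

lemma dir_deriv_chart_change:
  fixes \<phi> :: "'m \<Rightarrow> 'b::real_normed_vector"
  assumes c: "c \<in> atlas" "p \<in> chart_dom c" and d: "d \<in> atlas" "p \<in> chart_dom d"
    and W: "openin X W" "p \<in> W"
    and f: "\<And>q. q \<in> W \<Longrightarrow> q \<in> chart_dom c \<Longrightarrow> q \<in> chart_dom d \<Longrightarrow> f (chart_map c q) = h (chart_map d q)"
    and h: "h differentiable (at (chart_map d p))"
  shows "dir_deriv f (chart_map c p) = dir_deriv h (chart_map d p) \<circ> transition_deriv c d p"
proof -
  let ?S = "chart_map c ` (chart_dom c \<inter> (chart_dom d \<inter> W))"
  have "(h has_derivative dir_deriv h (chart_map d p)) (at (transition c d (chart_map c p)))"
    using h c frechet_derivative_works by (metis transition_chart_map)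
  then have "((h \<circ> transition c d) has_derivative dir_deriv h (chart_map d p) \<circ> transition_deriv c d p) (at (chart_map c p))"
    by (rule diff_chain_at[OF transition_has_derivative[OF c(1) d(1) c(2) d(2)]])
  then have "(f has_derivative dir_deriv h (chart_map d p) \<circ> transition_deriv c d p) (at (chart_map c p))"
  proof (rule has_derivative_transform_within_open)
    show "open ?S"
      by (intro open_chart_image_Int c openin_Int open_dom d W)
    show "chart_map c p \<in> ?S"
      using c d W by blast
    show "(h \<circ> transition c d) x = f x" if "x \<in> ?S" for x
      using that c f by auto
  qed
  then show ?thesis
    by (rule frechet_derivative_at[symmetric])
qed

lemma transition_deriv_cocycle:
  assumes "c \<in> atlas" "d \<in> atlas" "e \<in> atlas" "p \<in> chart_dom c" "p \<in> chart_dom d" "p \<in> chart_dom e"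
  shows "transition_deriv c e p u = transition_deriv d e p (transition_deriv c d p u)"
proof -
  have "transition d e differentiable (at (chart_map d p))"
    using transition_has_derivative[of d e p] assms differentiable_def by blast
  then have "dir_deriv (transition c e) (chart_map c p) = dir_deriv (transition d e) (chart_map d p) \<circ> transition_deriv c d p"
    using assms chart_dom_topspace[of c p]
    by (intro dir_deriv_chart_change[where W="topspace X"]) auto
  then show ?thesis
    unfolding transition_deriv_def by simp
qed

lemma transition_deriv_self:
  assumes "c \<in> atlas" "p \<in> chart_dom c"
  shows "transition_deriv c c p u = u"
proof -
  have "dir_deriv (transition c c) (chart_map c p) = dir_deriv (\<lambda>x. x) (chart_map c p)"
    using assms by (intro dir_deriv_cong[OF open_image]) (auto simp: transition_def)
  then show ?thesis
    by (simp add: transition_deriv_def)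
qed

lemma tangent_of_in_tangent_space:
  assumes "c \<in> atlas" "p \<in> chart_dom c"
  shows "tangent_of c p u \<in> tangent_space p"
proof -
  have "tangent_of c p u e = transition_deriv d e p (tangent_of c p u d)"
    if "d \<in> atlas" "e \<in> atlas" "p \<in> chart_dom d" "p \<in> chart_dom e" for d e
    using assms that transition_deriv_cocycle[of c d e p u] by (simp add: tangent_of_def)
  moreover have "tangent_of c p u d = 0" if "\<not> (d \<in> atlas \<and> p \<in> chart_dom d)" for d
    using that by (auto simp: tangent_of_def)
  ultimately show ?thesis
    unfolding tangent_space_def by blast
qed

lemma tangent_of_apply:
  "d \<in> atlas \<Longrightarrow> p \<in> chart_dom d \<Longrightarrow> tangent_of c p u d = transition_deriv c d p u"
  by (simp add: tangent_of_def)

lemma tangent_of_self [simp]: "c \<in> atlas \<Longrightarrow> p \<in> chart_dom c \<Longrightarrow> tangent_of c p u c = u"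
  by (simp add: tangent_of_apply transition_deriv_self)

lemma tangent_of_coord:
  assumes "c \<in> atlas" "p \<in> chart_dom c" "\<xi> \<in> tangent_space p"
  shows "tangent_of c p (\<xi> c) = \<xi>"
proof
  fix d
  show "tangent_of c p (\<xi> c) d = \<xi> d"
  proof (cases "d \<in> atlas \<and> p \<in> chart_dom d")
    case True
    then have "\<xi> d = transition_deriv c d p (\<xi> c)"
      using assms unfolding tangent_space_def by blast
    with True show ?thesis
      by (simp add: tangent_of_def)
  next
    case False
    then have "\<xi> d = 0"
      using assms(3) unfolding tangent_space_def by blast
    with False show ?thesis
      by (auto simp: tangent_of_def)
  qed
qed

lemma tangent_of_transition:
  assumes "c \<in> atlas" "d \<in> atlas" "p \<in> chart_dom c" "p \<in> chart_dom d"
  shows "tangent_of d p (transition_deriv c d p u) = tangent_of c p u"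
proof
  fix e
  show "tangent_of d p (transition_deriv c d p u) e = tangent_of c p u e"
    using assms transition_deriv_cocycle[of c d e p u] by (simp add: tangent_of_def)
qed

lemma tangent_of_add:
  assumes "c \<in> atlas" "p \<in> chart_dom c"
  shows "tangent_of c p (u + w) = (\<lambda>d. tangent_of c p u d + tangent_of c p w d)"
  using assms linear_add[OF linear_transition_deriv] by (auto simp: tangent_of_def fun_eq_iff)

lemma tangent_of_scale:
  assumes "c \<in> atlas" "p \<in> chart_dom c"
  shows "tangent_of c p (r *\<^sub>R u) = (\<lambda>d. r *\<^sub>R tangent_of c p u d)"
  using assms linear_scale[OF linear_transition_deriv] by (auto simp: tangent_of_def fun_eq_iff)

section \<open>Continuous and C1 functions, and derivatives along a vector field\<close>

text \<open>Continuity is expressed in charts because the integrals are taken there;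
  \<open>C0_fun_continuous_map\<close> recovers continuity on \<open>X\<close>, which the existence
  of a maximum needs.\<close>

definition C0_fun :: "('m \<Rightarrow> real) \<Rightarrow> bool"
  where "C0_fun \<phi> \<longleftrightarrow> (\<forall>c\<in>atlas. continuous_on (chart_image c) (\<lambda>x. \<phi> (chart_inv c x)))"

definition C1_fun :: "('m \<Rightarrow> real) \<Rightarrow> bool"
  where "C1_fun \<phi> \<longleftrightarrow> (\<forall>c\<in>atlas. C1_on (chart_image c) (\<lambda>x. \<phi> (chart_inv c x)))"

lemma C1_fun_imp_C0_fun: "C1_fun \<phi> \<Longrightarrow> C0_fun \<phi>"
  unfolding C1_fun_def C0_fun_def using C1_on_continuous by blast

lemma C0_fun_mult: "C0_fun \<phi> \<Longrightarrow> C0_fun \<psi> \<Longrightarrow> C0_fun (\<lambda>p. \<phi> p * \<psi> p)"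
  unfolding C0_fun_def by (auto intro!: continuous_intros)

lemma C0_fun_add: "C0_fun \<phi> \<Longrightarrow> C0_fun \<psi> \<Longrightarrow> C0_fun (\<lambda>p. \<phi> p + \<psi> p)"
  unfolding C0_fun_def by (auto intro!: continuous_intros)

lemma C1_fun_mult: "C1_fun \<phi> \<Longrightarrow> C1_fun \<psi> \<Longrightarrow> C1_fun (\<lambda>p. \<phi> p * \<psi> p)"
  unfolding C1_fun_def by (intro ballI C1_on_mult) auto

lemma C1_fun_sum: "(\<And>i. i \<in> I \<Longrightarrow> C1_fun (\<phi> i)) \<Longrightarrow> C1_fun (\<lambda>p. \<Sum>i\<in>I. \<phi> i p)"
  unfolding C1_fun_def by (intro ballI C1_on_sum) auto

lemma C1_fun_inverse:
  assumes "C1_fun \<phi>" "\<And>p. p \<in> topspace X \<Longrightarrow> \<phi> p \<noteq> 0"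
  shows "C1_fun (\<lambda>p. inverse (\<phi> p))"
  unfolding C1_fun_def
proof
  fix c assume c: "c \<in> atlas"
  show "C1_on (chart_image c) (\<lambda>x. inverse (\<phi> (chart_inv c x)))"
    using assms c chart_dom_topspace[OF c chart_inv_in_dom]
    by (intro C1_on_inverse) (auto simp: C1_fun_def)
qed

text \<open>The derivative V(\<phi>). An arbitrary chart around \<open>p\<close> is chosen; for
  tangent \<open>V p\<close> and \<phi> of class C1, \<open>field_deriv_eq\<close> allows any
  other.\<close>

definition field_deriv :: "('m \<Rightarrow> ('m, 'e) chart \<Rightarrow> 'e) \<Rightarrow> ('m \<Rightarrow> real) \<Rightarrow> 'm \<Rightarrow> real"
  where "field_deriv V \<phi> p =
    (let c = SOME c. c \<in> atlas \<and> p \<in> chart_dom c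
     in dir_deriv (\<lambda>x. \<phi> (chart_inv c x)) (chart_map c p) (V p c))"

text \<open>A change of chart composes the derivative of \<phi> with
  \<open>transition_deriv c d p\<close>, and tangency of \<open>V p\<close> says that this map sends
  the coordinates in \<open>c\<close> to those in \<open>d\<close>.\<close>

lemma field_deriv_eq:
  assumes \<phi>: "C1_fun \<phi>" and V: "V p \<in> tangent_space p" and c: "c \<in> atlas" "p \<in> chart_dom c"
  shows "field_deriv V \<phi> p = dir_deriv (\<lambda>x. \<phi> (chart_inv c x)) (chart_map c p) (V p c)"
proof -
  define d where "d = (SOME c. c \<in> atlas \<and> p \<in> chart_dom c)"
  have d: "d \<in> atlas" "p \<in> chart_dom d"
    using someI[of "\<lambda>c. c \<in> atlas \<and> p \<in> chart_dom c" c] c unfolding d_def by auto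
  have "(\<lambda>x. \<phi> (chart_inv d x)) differentiable (at (chart_map d p))"
    using \<phi> d by (intro C1_on_differentiable[of "chart_image d"]) (auto simp: C1_fun_def)
  then have "dir_deriv (\<lambda>x. \<phi> (chart_inv c x)) (chart_map c p)
      = dir_deriv (\<lambda>x. \<phi> (chart_inv d x)) (chart_map d p) \<circ> transition_deriv c d p"
    using c d chart_dom_topspace[OF c] by (intro dir_deriv_chart_change[where W="topspace X"]) auto
  moreover have "V p d = transition_deriv c d p (V p c)"
    using V c d unfolding tangent_space_def by blast
  ultimately show ?thesis
    by (simp add: field_deriv_def Let_def d_def[symmetric])
qed

lemma C0_fun_field_deriv:
  assumes \<phi>: "C1_fun \<phi>" and V: "smooth_vector_field V"
  shows "C0_fun (field_deriv V \<phi>)"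
  unfolding C0_fun_def
proof
  fix c assume c: "c \<in> atlas"
  let ?f = "\<lambda>x. \<phi> (chart_inv c x)"
  have f: "C1_on (chart_image c) ?f"
    using \<phi> c unfolding C1_fun_def by blast
  have v: "C1_on (chart_image c) (local_field V c)"
    using V c smooth_on_imp_C1_on unfolding smooth_vector_field_def by blast
  have "continuous_on (chart_image c) (\<lambda>x. \<Sum>b\<in>Basis. (local_field V c x \<bullet> b) * dir_deriv ?f x b)"
    by (intro continuous_intros C1_on_continuous_deriv[OF f] C1_on_continuous[OF v])
  moreover have "(\<Sum>b\<in>Basis. (local_field V c x \<bullet> b) * dir_deriv ?f x b) = field_deriv V \<phi> (chart_inv c x)"
    if x: "x \<in> chart_image c" for x
  proof -
    have l: "linear (dir_deriv ?f x)"
      using C1_on_has_derivative[OF f x] has_derivative_linear by blast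
    have "V (chart_inv c x) \<in> tangent_space (chart_inv c x)"
      using V x chart_dom_subset[OF c] chart_inv_in_dom[OF x] unfolding smooth_vector_field_def by blast
    then have "field_deriv V \<phi> (chart_inv c x) = dir_deriv ?f x (local_field V c x)"
      using field_deriv_eq[OF \<phi> _ c, where p="chart_inv c x" and V=V] x by (simp add: local_field_def)
    also have "\<dots> = dir_deriv ?f x (\<Sum>b\<in>Basis. (local_field V c x \<bullet> b) *\<^sub>R b)"
      by (simp add: euclidean_representation)
    also have "\<dots> = (\<Sum>b\<in>Basis. (local_field V c x \<bullet> b) * dir_deriv ?f x b)"
      by (simp only: linear_sum[OF l] linear_scale[OF l] real_scaleR_def)
    finally show ?thesis by simp
  qed
  ultimately show "continuous_on (chart_image c) (\<lambda>x. field_deriv V \<phi> (chart_inv c x))"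
    by (simp cong: continuous_on_cong)
qed

lemma chart_cover: "p \<in> topspace X \<Longrightarrow> \<exists>c\<in>atlas. p \<in> chart_dom c"
  using cover by blast

lemma compact_chart_image:
  assumes "c \<in> atlas" "compactin X P" "P \<subseteq> chart_dom c"
  shows "compact (chart_map c ` P)"
proof -
  have "compactin (subtopology X (chart_dom c)) P"
    using assms by (simp add: compactin_subtopology)
  then have "compactin (top_of_set (chart_image c)) (chart_map c ` P)"
    using image_compactin homeomorphic_imp_continuous_map[OF homeo[OF assms(1)]] by blast
  then show ?thesis
    by (simp add: compactin_subtopology)
qed

lemma C0_fun_continuous_map:
  assumes "C0_fun \<phi>"
  shows "continuous_map X euclideanreal \<phi>"
  unfolding continuous_map_def
proof (intro conjI allI impI)
  fix W :: "real set" assume "openin euclideanreal W"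
  then have W: "open W" by simp
  have "{p \<in> chart_dom c. chart_map c p \<in> {x \<in> chart_image c. \<phi> (chart_inv c x) \<in> W}}
      = {p \<in> chart_dom c. \<phi> p \<in> W}" if "c \<in> atlas" for c
    using that by auto
  moreover have "openin X {p \<in> chart_dom c. chart_map c p \<in> {x \<in> chart_image c. \<phi> (chart_inv c x) \<in> W}}"
    if c: "c \<in> atlas" for c
  proof (rule openin_chart_vimage[OF c])
    have "continuous_on (chart_image c) (\<lambda>x. \<phi> (chart_inv c x))"
      using assms c unfolding C0_fun_def by blast
    then show "open {x \<in> chart_image c. \<phi> (chart_inv c x) \<in> W}"
      using continuous_open_preimage[OF _ open_image[OF c] W] by (simp add: vimage_def Int_def)
  qed
  ultimately have "openin X (\<Union>c\<in>atlas. {p \<in> chart_dom c. \<phi> p \<in> W})"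
    by auto
  moreover have "(\<Union>c\<in>atlas. {p \<in> chart_dom c. \<phi> p \<in> W}) = {p \<in> topspace X. \<phi> p \<in> W}"
    unfolding cover[symmetric] by blast
  ultimately show "openin X {p \<in> topspace X. \<phi> p \<in> W}"
    by simp
qed auto

lemma C0_fun_attains_max:
  assumes "C0_fun \<phi>" "compact_space X" "topspace X \<noteq> {}"
  obtains p where "p \<in> topspace X" "\<And>q. q \<in> topspace X \<Longrightarrow> \<phi> q \<le> \<phi> p"
proof -
  have "compact (\<phi> ` topspace X)"
    using image_compactin[OF _ C0_fun_continuous_map[OF assms(1)], of "topspace X"] assms(2)
    by (simp add: compact_space_def)
  then show ?thesis
    using compact_attains_sup[of "\<phi> ` topspace X"] assms(3) that by auto
qed

section \<open>Bump functions and a finite partition of unity\<close>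

text \<open>A Euclidean bump on a closed ball inside the chart image is pulled back and extended by
  0. The preimage \<open>P\<close> of the closed ball serves as a compact set containing the
  support, and \<open>W\<close>, the preimage of the open ball, is where positivity is
  guaranteed.\<close>

lemma bump_function:
  assumes "p \<in> topspace X"
  obtains c P \<beta> W where "c \<in> atlas" "P \<subseteq> chart_dom c" "compactin X P" "C1_fun \<beta>"
    "\<And>q. \<beta> q \<ge> 0" "\<And>q. q \<in> topspace X - P \<Longrightarrow> \<beta> q = 0"
    "openin X W" "p \<in> W" "\<And>q. q \<in> W \<Longrightarrow> \<beta> q > 0"
proof -
  obtain c where c: "c \<in> atlas" "p \<in> chart_dom c"
    using chart_cover assms by blast
  define x0 where "x0 = chart_map c p"
  obtain r where r: "r > 0" "cball x0 r \<subseteq> chart_image c"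
    using open_image[OF c(1)] c(2) unfolding x0_def by (meson chart_map_in_image open_contains_cball)
  define P where "P = chart_inv c ` cball x0 r"
  define \<eta> where "\<eta> y = (max 0 (r\<^sup>2 - (norm (y - x0))\<^sup>2))\<^sup>2" for y
  define \<beta> where "\<beta> q = (if q \<in> chart_dom c then \<eta> (chart_map c q) else 0)" for q
  define W where "W = {q \<in> chart_dom c. chart_map c q \<in> ball x0 r}"
  have P: "compactin X P" "P \<subseteq> chart_dom c"
    using r c compactin_chart_inv unfolding P_def by (auto dest: chart_inv_in_dom)
  have zero: "\<beta> q = 0" if "q \<notin> P" for q
  proof (cases "q \<in> chart_dom c")
    case True
    then have "chart_map c q \<notin> cball x0 r"
      using that c unfolding P_def by (metis chart_inv_map imageI)
    then have "r\<^sup>2 \<le> (norm (chart_map c q - x0))\<^sup>2"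
      using r(1) by (simp add: dist_norm norm_minus_commute)
    then show ?thesis
      by (simp add: \<beta>_def \<eta>_def)
  qed (simp add: \<beta>_def)
  have "C1_fun \<beta>"
    unfolding C1_fun_def
  proof
    fix e assume e: "e \<in> atlas"
    let ?\<beta> = "\<lambda>x. \<beta> (chart_inv e x)"
    \<comment> \<open>In another chart \<open>e\<close> the extension by 0 must be C1 across the
      boundary of the domain of \<open>c\<close>. The Hausdorff property makes \<open>P\<close>
      closed, so \<open>?Z\<close> is open; \<beta> is 0 on it, and together with the overlap it
      covers the image of \<open>e\<close>.\<close>
    let ?Z = "chart_map e ` (chart_dom e \<inter> (topspace X - P))"
    have "closedin X P"
      using Hausdorff P(1) compactin_imp_closedin by blast
    then have openZ: "open ?Z"
      by (intro open_chart_image_Int e) (simp add: openin_diff)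
    have "C1_on (overlap e c) (\<lambda>x. \<eta> (transition e c x))"
      unfolding \<eta>_def by (rule C1_on_compose[OF C1_on_bump C1_on_transition[OF e c(1)]]) simp
    then have "C1_on (overlap e c) ?\<beta>"
      by (rule C1_on_cong[OF open_overlap[OF e c(1)], rotated]) (use e in \<open>auto simp: overlap_def \<beta>_def\<close>)
    moreover have "C1_on ?Z ?\<beta>"
      using e zero by (intro C1_on_cong[OF openZ _ C1_on_const[of _ 0]]) auto
    ultimately have "C1_on (overlap e c \<union> ?Z) ?\<beta>"
      using openZ open_overlap[OF e c(1)] by (intro C1_on_Un)
    moreover have "overlap e c \<union> ?Z = chart_image e"
      using chart_dom_subset[OF e] P(2) by (auto simp: overlap_def chart_image_def)
    ultimately show "C1_on (chart_image e) ?\<beta>"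
      by simp
  qed
  moreover have "openin X W"
    unfolding W_def by (intro openin_chart_vimage c) simp
  moreover have "p \<in> W"
    using c r by (simp add: W_def x0_def)
  moreover have "\<beta> q > 0" if "q \<in> W" for q
  proof -
    have "(norm (chart_map c q - x0))\<^sup>2 < r\<^sup>2"
      using that r(1) by (intro power_strict_mono) (auto simp: W_def dist_norm norm_minus_commute)
    then show ?thesis
      using that by (simp add: \<beta>_def \<eta>_def W_def)
  qed
  moreover have "\<beta> q \<ge> 0" for q
    by (simp add: \<beta>_def \<eta>_def)
  ultimately show ?thesis
    using that c(1) P zero by blast
qed

text \<open>Compactness leaves finitely many of the sets \<open>W p\<close>; the index set consists
  of their points \<open>p\<close>. The sum \<open>S\<close> of the chosen bumps is positive
  everywhere, so dividing by it normalises them without enlarging the sets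
  \<open>P i\<close>.\<close>

lemma partition_of_unity:
  assumes "compact_space X"
  obtains F :: "'m set" and c P \<rho> where "finite F"
    "\<forall>i\<in>F. c i \<in> atlas \<and> P i \<subseteq> chart_dom (c i) \<and> compactin X (P i) \<and> C1_fun (\<rho> i)"
    "\<forall>i\<in>F. \<forall>q\<in>topspace X. \<rho> i q \<ge> 0"
    "\<forall>i\<in>F. \<forall>q\<in>topspace X - P i. \<rho> i q = 0"
    "\<forall>q\<in>topspace X. (\<Sum>i\<in>F. \<rho> i q) = 1"
proof -
  have "\<forall>p\<in>topspace X. \<exists>c P \<beta> W. c \<in> atlas \<and> P \<subseteq> chart_dom c \<and> compactin X P \<and> C1_fun \<beta> \<and>
    (\<forall>q. \<beta> q \<ge> 0) \<and> (\<forall>q\<in>topspace X - P. \<beta> q = 0) \<and> openin X W \<and> p \<in> W \<and> (\<forall>q\<in>W. \<beta> q > 0)"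
    using bump_function by metis
  then obtain c P \<beta> W where *: "\<And>p. p \<in> topspace X \<Longrightarrow> c p \<in> atlas \<and> P p \<subseteq> chart_dom (c p) \<and>
    compactin X (P p) \<and> C1_fun (\<beta> p) \<and> (\<forall>q. \<beta> p q \<ge> 0) \<and> (\<forall>q\<in>topspace X - P p. \<beta> p q = 0) \<and>
    openin X (W p) \<and> p \<in> W p \<and> (\<forall>q\<in>W p. \<beta> p q > (0::real))"
    by metis
  have "compactin X (topspace X)"
    using assms by (simp add: compact_space_def)
  moreover have "\<And>U. U \<in> W ` topspace X \<Longrightarrow> openin X U" "topspace X \<subseteq> \<Union>(W ` topspace X)"
    using * by blast+
  ultimately obtain \<F> where \<F>: "finite \<F>" "\<F> \<subseteq> W ` topspace X" "topspace X \<subseteq> \<Union>\<F>"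
    using compactinD[of X "topspace X" "W ` topspace X"] by blast
  then obtain F where F: "finite F" "F \<subseteq> topspace X" "\<F> = W ` F"
    by (metis finite_subset_image)
  define S where "S q = (\<Sum>i\<in>F. \<beta> i q)" for q
  have S: "S q > 0" if "q \<in> topspace X" for q
  proof -
    from that \<F>(3) F(3) obtain i where "i \<in> F" "q \<in> W i"
      by blast
    then show ?thesis
      unfolding S_def using * F by (intro sum_pos2[of F i]) auto
  qed
  have "C1_fun S"
    unfolding S_def[abs_def] by (intro C1_fun_sum) (use * F in blast)
  then have C1S: "C1_fun (\<lambda>q. inverse (S q))"
    by (rule C1_fun_inverse) (use S in force)
  show ?thesis
  proof (rule that[of F c P "\<lambda>i q. \<beta> i q * inverse (S q)"])
    show "\<forall>i\<in>F. c i \<in> atlas \<and> P i \<subseteq> chart_dom (c i) \<and> compactin X (P i) \<and> C1_fun (\<lambda>q. \<beta> i q * inverse (S q))"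
      using * F C1_fun_mult[OF _ C1S] by blast
    show "\<forall>i\<in>F. \<forall>q\<in>topspace X. \<beta> i q * inverse (S q) \<ge> 0"
      using * F S by (intro ballI mult_nonneg_nonneg) (auto simp: less_imp_le)
    show "\<forall>i\<in>F. \<forall>q\<in>topspace X - P i. \<beta> i q * inverse (S q) = 0"
      using * F by (auto simp: subset_iff)
    show "\<forall>q\<in>topspace X. (\<Sum>i\<in>F. \<beta> i q * inverse (S q)) = 1"
      using S by (force simp: sum_distrib_right[symmetric] S_def[symmetric])
  qed (rule F)
qed

text \<open>Applied with \<open>k = 0\<close> to a cut-off function off its set \<open>P i\<close>,
  and with \<open>k = 1\<close> to the sum of a partition of unity.\<close>

lemma field_deriv_zero:
  assumes \<phi>: "C1_fun \<phi>" and V: "V p \<in> tangent_space p" and W: "openin X W" "p \<in> W"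
    and const: "\<And>q. q \<in> W \<Longrightarrow> \<phi> q = k"
  shows "field_deriv V \<phi> p = 0"
proof -
  obtain c where c: "c \<in> atlas" "p \<in> chart_dom c"
    using chart_cover W openin_subset by blast
  have "dir_deriv (\<lambda>x. \<phi> (chart_inv c x)) (chart_map c p) = dir_deriv (\<lambda>_. k) (chart_map c p)"
    using c W const
    by (intro dir_deriv_cong[OF open_chart_image_Int[OF c(1) W(1)]]) auto
  then show ?thesis
    by (simp add: field_deriv_eq[where V=V and p=p, OF \<phi> V c])
qed

lemma field_deriv_sum:
  assumes \<phi>: "\<And>i. i \<in> I \<Longrightarrow> C1_fun (\<phi> i)" and V: "V p \<in> tangent_space p" and p: "p \<in> topspace X"
  shows "field_deriv V (\<lambda>q. \<Sum>i\<in>I. \<phi> i q) p = (\<Sum>i\<in>I. field_deriv V (\<phi> i) p)"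
proof -
  obtain c where c: "c \<in> atlas" "p \<in> chart_dom c"
    using chart_cover p by blast
  have "((\<lambda>x. \<phi> i (chart_inv c x)) has_derivative dir_deriv (\<lambda>x. \<phi> i (chart_inv c x)) (chart_map c p)) (at (chart_map c p))"
    if "i \<in> I" for i
    using \<phi>[OF that] c unfolding C1_fun_def by (intro C1_on_has_derivative[of "chart_image c"]) auto
  then have "((\<lambda>x. \<Sum>i\<in>I. \<phi> i (chart_inv c x)) has_derivative
      (\<lambda>h. \<Sum>i\<in>I. dir_deriv (\<lambda>x. \<phi> i (chart_inv c x)) (chart_map c p) h)) (at (chart_map c p))"
    by (rule has_derivative_sum)
  from frechet_derivative_at[OF this, symmetric] show ?thesis
    using field_deriv_eq[where V=V and p=p and \<phi>="\<lambda>q. \<Sum>i\<in>I. \<phi> i q", OF C1_fun_sum[OF \<phi>] V c]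
      field_deriv_eq[where V=V and p=p, OF \<phi> V c] by simp
qed

end

section \<open>The Riemannian density\<close>

context riemannian_manifold
begin

lemma local_form_eq:
  assumes "c \<in> atlas" "p \<in> chart_dom c"
  shows "local_form g c (chart_map c p) u w = g p (tangent_of c p u) (tangent_of c p w)"
  using assms by (simp add: local_form_def)

lemma local_form_coord:
  assumes "c \<in> atlas" "p \<in> chart_dom c" "\<xi> \<in> tangent_space p" "\<eta> \<in> tangent_space p"
  shows "local_form g c (chart_map c p) (\<xi> c) (\<eta> c) = g p \<xi> \<eta>"
  using assms by (simp add: local_form_eq tangent_of_coord)

context
  fixes c :: "('m, 'e) chart" and x :: 'e
  assumes c: "c \<in> atlas" and x: "x \<in> chart_image c"
begin

lemma local_form_sym: "local_form g c x u w = local_form g c x w u"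
  unfolding local_form_def using c x
  by (intro metric_sym tangent_of_in_tangent_space chart_dom_topspace[OF c]) auto

lemma bilinear_local_form: "bilinear (local_form g c x)"
proof -
  have lin: "linear (\<lambda>u. local_form g c x u w)" for w
    unfolding local_form_def using c x
    by (intro linearI)
      (simp_all add: tangent_of_add tangent_of_scale metric_add metric_scale tangent_of_in_tangent_space
        chart_dom_topspace[OF c])
  moreover have "linear (local_form g c x w)" for w
    using lin[of w] local_form_sym[of w] by presburger
  ultimately show ?thesis
    by (simp add: bilinear_def)
qed

lemma local_form_pos: "u \<noteq> 0 \<Longrightarrow> local_form g c x u u > 0"
  unfolding local_form_def using c x
  by (intro metric_pos tangent_of_in_tangent_space chart_dom_topspace[OF c])
    (auto dest: fun_cong[where x=c])

lemma local_form_differentiable: "(\<lambda>y. local_form g c y u w) differentiable (at x)"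
  using C1_on_differentiable[OF smooth_on_imp_C1_on[OF metric_smooth[OF c]] x] .

end

lemma local_form_transition:
  assumes "c \<in> atlas" "d \<in> atlas" "x \<in> overlap c d"
  shows "local_form g c x u w =
    local_form g d (transition c d x) (dir_deriv (transition c d) x u) (dir_deriv (transition c d) x w)"
proof -
  obtain p where p: "p \<in> chart_dom c" "p \<in> chart_dom d" "x = chart_map c p"
    using assms by (auto simp: overlap_def)
  then have "dir_deriv (transition c d) x = transition_deriv c d p"
    by (simp add: transition_deriv_def)
  then show ?thesis
    using assms p by (simp add: local_form_eq tangent_of_transition)
qed

definition gram :: "('m, 'e) chart \<Rightarrow> 'e \<Rightarrow> real ^ 'e basis ^ 'e basis"
  where "gram c x = (\<chi> i j. local_form g c x (basis_vec i) (basis_vec j))"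

text \<open>The absolute value avoids a proof that the Gram determinant is positive.\<close>

definition density :: "('m, 'e) chart \<Rightarrow> 'e \<Rightarrow> real"
  where "density c x = sqrt \<bar>det (gram c x)\<bar>"

lemma gram_left_inverse:
  assumes "c \<in> atlas" "x \<in> chart_image c"
  obtains B where "B ** gram c x = mat 1"
  using gram_matrix_left_invertible[OF bilinear_local_form[OF assms] local_form_pos[OF assms]]
  unfolding gram_def by blast

lemma det_gram_nonzero:
  assumes "c \<in> atlas" "x \<in> chart_image c"
  shows "det (gram c x) \<noteq> 0"
  using gram_left_inverse[OF assms] by (metis det_I det_mul mult_zero_right zero_neq_one)

lemma density_pos: "c \<in> atlas \<Longrightarrow> x \<in> chart_image c \<Longrightarrow> density c x > 0"
  by (simp add: density_def det_gram_nonzero)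

lemma C1_on_gram: "c \<in> atlas \<Longrightarrow> C1_on (chart_image c) (\<lambda>x. gram c x $ i $ j)"
  unfolding gram_def vec_lambda_beta by (intro smooth_on_imp_C1_on metric_smooth)

lemma C1_on_density:
  assumes "c \<in> atlas"
  shows "C1_on (chart_image c) (density c)"
proof -
  have "C1_on (- {0}) (\<lambda>t. sqrt \<bar>t\<bar> :: real)"
    using has_real_derivative_sqrt_abs
    by (intro C1_on_field_derivative[where f'="\<lambda>t. sqrt \<bar>t\<bar> / (2 * t)"]) (auto intro!: continuous_intros)
  then show ?thesis
    unfolding density_def[abs_def]
    by (rule C1_on_compose[OF _ C1_on_det[OF C1_on_gram[OF assms]]]) (use det_gram_nonzero[OF assms] in auto)
qed

text \<open>Jacobi's formula composed with the derivative of sqrt |t|: the determinant cancels,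
  leaving d sqrt |det g| = 1/2 sqrt |det g| tr (g^-1 dg).\<close>

lemma density_has_derivative:
  assumes c: "c \<in> atlas" and x: "x \<in> chart_image c" and B: "B ** gram c x = mat 1"
  shows "(density c has_derivative (\<lambda>h. density c x * trace (B **
    (\<chi> i j. dir_deriv (\<lambda>y. local_form g c y (basis_vec i) (basis_vec j)) x h)) / 2)) (at x)"
proof -
  let ?d = "det (gram c x)"
  let ?H = "\<lambda>h. \<chi> i j. dir_deriv (\<lambda>y. local_form g c y (basis_vec i) (basis_vec j)) x h"
  have d: "((\<lambda>y. det (gram c y)) has_derivative (\<lambda>h. ?d * trace (B ** ?H h))) (at x)"
    using local_form_differentiable[OF c x] B
    by (intro has_derivative_det) (simp_all add: gram_def frechet_derivative_works)
  have "((\<lambda>t. sqrt \<bar>t\<bar>) has_derivative (*) (density c x / (2 * ?d))) (at ?d)"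
    using has_real_derivative_sqrt_abs[OF det_gram_nonzero[OF c x]]
    by (simp add: has_field_derivative_def density_def)
  from has_derivative_compose[OF d this] show ?thesis
    using det_gram_nonzero[OF c x] by (simp add: density_def[abs_def])
qed

text \<open>With J the Jacobian matrix, the Gram matrix changes to J^T G J, so its determinant gains
  the factor (det J)^2 and the square root gains |det J|, whatever the orientation of the
  charts.\<close>

lemma density_transition:
  assumes c: "c \<in> atlas" and d: "d \<in> atlas" and x: "x \<in> overlap c d"
  shows "density c x = \<bar>det (matrix_of (dir_deriv (transition c d) x))\<bar> * density d (transition c d x)"
proof -
  let ?T = "dir_deriv (transition c d) x"
  have "transition c d x \<in> chart_image d"
    using transition_image[OF c, of d] x overlap_subset by blast
  then have "gram c x = transpose (matrix_of ?T) ** gram d (transition c d x) ** matrix_of ?T"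
    unfolding gram_def local_form_transition[OF c d x]
    by (intro gram_matrix_linear bilinear_local_form d)
  then show ?thesis
    by (simp add: density_def det_mul abs_mult real_sqrt_mult)
qed

section \<open>Integration in a single chart\<close>

text \<open>The integral against the Riemannian volume over the domain of \<open>c\<close> alone. It
  stands for an integral over all of \<open>X\<close> when \<phi> vanishes off a compact subset of
  that domain.\<close>

definition integ :: "('m, 'e) chart \<Rightarrow> ('m \<Rightarrow> real) \<Rightarrow> real"
  where "integ c \<phi> = integral (chart_image c) (\<lambda>x. \<phi> (chart_inv c x) * density c x)"

context
  fixes c :: "('m, 'e) chart" and P :: "'m set"
  assumes c: "c \<in> atlas" and P: "P \<subseteq> chart_dom c" "compact (chart_map c ` P)"
begin

text \<open>The set \<open>S\<close> is left open between the image of \<open>P\<close> and the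
  chart image, because both the whole image and an overlap with another chart occur.\<close>

lemma compact_support_integrand:
  assumes \<phi>: "C0_fun \<phi>" and zero: "\<And>p. p \<in> topspace X - P \<Longrightarrow> \<phi> p = 0"
    and S: "chart_map c ` P \<subseteq> S" "S \<subseteq> chart_image c"
  shows "(\<lambda>x. \<phi> (chart_inv c x) * density c x) absolutely_integrable_on S"
proof (rule absolutely_integrable_compact_support)
  show "continuous_on S (\<lambda>x. \<phi> (chart_inv c x) * density c x)"
    using \<phi> c S(2) C1_on_continuous[OF C1_on_density[OF c]] unfolding C0_fun_def
    by (intro continuous_intros) (auto intro: continuous_on_subset)
  show "\<phi> (chart_inv c x) * density c x = 0" if "x \<in> S - chart_map c ` P" for x
  proof -
    have x: "x \<in> chart_image c" using that S by blast
    then have "chart_inv c x \<in> topspace X"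
      by (intro chart_dom_topspace[OF c] chart_inv_in_dom)
    moreover have "chart_inv c x \<notin> P"
      using that x by (metis DiffD2 chart_map_inv image_eqI)
    ultimately show ?thesis
      using zero by simp
  qed
qed (use P S in auto)

lemma integ_sum:
  assumes "\<And>i. i \<in> I \<Longrightarrow> C0_fun (\<phi> i)" "\<And>i p. i \<in> I \<Longrightarrow> p \<in> topspace X - P \<Longrightarrow> \<phi> i p = 0"
    and "finite I"
  shows "integ c (\<lambda>p. \<Sum>i\<in>I. \<phi> i p) = (\<Sum>i\<in>I. integ c (\<phi> i))"
proof -
  have "(\<lambda>x. \<phi> i (chart_inv c x) * density c x) integrable_on chart_image c" if "i \<in> I" for i
    using assms that P(1)
    by (intro set_lebesgue_integral_eq_integral(1) compact_support_integrand) auto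
  then show ?thesis
    unfolding integ_def sum_distrib_right by (intro integral_sum assms)
qed

text \<open>Since \<phi> vanishes off \<open>P\<close>, which lies in both domains, each integral
  reduces to the overlap; there the Jacobian factor of the substitution is exactly the one relating
  the two densities.\<close>

lemma integ_chart_change:
  assumes d: "d \<in> atlas" and Pd: "P \<subseteq> chart_dom d"
    and \<phi>: "C0_fun \<phi>" and zero: "\<And>p. p \<in> topspace X - P \<Longrightarrow> \<phi> p = 0"
  shows "integ c \<phi> = integ d \<phi>"
proof -
  let ?T = "transition c d" and ?S = "overlap c d"
  let ?f = "\<lambda>e x. \<phi> (chart_inv e x) * density e x"
  have restrict: "integ e \<phi> = integral (overlap e e') (?f e)"
    if e: "e \<in> atlas" and e': "e' \<in> atlas" and Pe: "P \<subseteq> chart_dom e \<inter> chart_dom e'" for e e'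
  proof -
    have "integ e \<phi> = integral (chart_image e) (\<lambda>x. if x \<in> overlap e e' then ?f e x else 0)"
      unfolding integ_def
    proof (rule integral_cong)
      fix x assume x: "x \<in> chart_image e"
      have "\<phi> (chart_inv e x) = 0" if "x \<notin> overlap e e'"
      proof (rule zero)
        have "chart_inv e x \<notin> P"
          using that Pe x overlap_iff[OF e] by blast
        then show "chart_inv e x \<in> topspace X - P"
          using chart_dom_topspace[OF e chart_inv_in_dom[OF x]] by blast
      qed
      then show "?f e x = (if x \<in> overlap e e' then ?f e x else 0)"
        by simp
    qed
    then show ?thesis
      by (simp add: integral_restrict_Int Int_absorb2[OF overlap_subset])
  qed
  have T: "C1_on ?S ?T"
    by (intro C1_on_transition c d)
  have "integral (?T ` ?S) (?f d) = integral ?S (?f c)"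
  proof -
    have "continuous_on ?S (\<lambda>x. det (matrix_of (dir_deriv ?T x)))"
      unfolding det_def matrix_of_def vec_lambda_beta
      by (intro continuous_intros C1_on_continuous_deriv[OF T])
    moreover have "continuous_on (?T ` ?S) (?f d)"
      unfolding transition_image[OF c]
      using \<phi> d overlap_subset[of d c] C1_on_continuous[OF C1_on_density[OF d]] unfolding C0_fun_def
      by (intro continuous_intros) (auto intro: continuous_on_subset)
    moreover have eq: "\<bar>det (matrix_of (dir_deriv ?T x))\<bar> * ?f d (?T x) = ?f c x" if "x \<in> ?S" for x
      using density_transition[OF c d that] chart_inv_transition[OF c d that] by simp
    moreover have "?f c absolutely_integrable_on ?S"
      using zero P Pd by (intro compact_support_integrand \<phi> overlap_subset) (auto simp: overlap_def)
    then have "(\<lambda>x. \<bar>det (matrix_of (dir_deriv ?T x))\<bar> * ?f d (?T x)) absolutely_integrable_on ?S"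
      by (rule set_integrable_cong[THEN iffD1, rotated -1]) (simp_all add: eq)
    moreover have "integral ?S (\<lambda>x. \<bar>det (matrix_of (dir_deriv ?T x))\<bar> * ?f d (?T x)) = integral ?S (?f c)"
      by (intro integral_cong eq)
    \<comment> \<open>The change of variables equivalence is read from left to right, with the
      integral in the coordinates of \<open>c\<close> as the value \<open>b\<close>.\<close>
    ultimately show ?thesis
      using absolutely_integrable_change_of_variables_euclidean[of ?S ?T "dir_deriv ?T" "?f d" "integral ?S (?f c)"]
        C1_on_has_derivative[OF T] open_overlap[OF c d] open_overlap[OF d c] inj_transition[OF c d]
        transition_image[OF c, of d] by simp
  qed
  then show ?thesis
    using restrict[OF c d] restrict[OF d c] P(1) Pd by (simp add: transition_image[OF c])
qed

end

end

section \<open>Modified homothetic vector fields\<close>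

text \<open>The constant \<sigma>, existentially bound in \<open>modified_homothetic\<close>,
  becomes a parameter here because \<open>divergence\<close> is expressed through it.\<close>

locale modified_homothetic_field = riemannian_manifold X atlas g
  for X :: "'m topology" and atlas :: "('m, 'e::euclidean_space) chart set" and g +
  fixes V :: "'m \<Rightarrow> ('m, 'e) chart \<Rightarrow> 'e" and m \<sigma> :: real
  assumes smooth_V: "smooth_vector_field V" and m_pos: "m > 0"
    and homothetic: "\<lbrakk>c \<in> atlas; p \<in> chart_dom c; \<xi> \<in> tangent_space p; \<eta> \<in> tangent_space p\<rbrakk> \<Longrightarrow>
      1/2 * lie_deriv_metric V c p \<xi> \<eta> - 1/m * (flat V p \<xi> * flat V p \<eta>) = \<sigma> * g p \<xi> \<eta>"
begin

abbreviation sqnorm :: "'m \<Rightarrow> real"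
  where "sqnorm p \<equiv> g p (V p) (V p)"

text \<open>The divergence of \<open>V\<close>, according to the trace of the homothety equation.\<close>

definition divergence :: "'m \<Rightarrow> real"
  where "divergence p = \<sigma> * DIM('e) + sqnorm p / m"

lemma V_tangent: "p \<in> topspace X \<Longrightarrow> V p \<in> tangent_space p"
  using smooth_V unfolding smooth_vector_field_def by blast

lemma C1_on_local_field: "c \<in> atlas \<Longrightarrow> C1_on (chart_image c) (local_field V c)"
  using smooth_V smooth_on_imp_C1_on unfolding smooth_vector_field_def by blast

lemma homothetic_local:
  assumes c: "c \<in> atlas" and x: "x \<in> chart_image c"
  shows "1/2 * (dir_deriv (\<lambda>y. local_form g c y u w) x (local_field V c x)
      + local_form g c x (dir_deriv (local_field V c) x u) w
      + local_form g c x u (dir_deriv (local_field V c) x w))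
    - 1/m * (local_form g c x (local_field V c x) u * local_form g c x (local_field V c x) w)
    = \<sigma> * local_form g c x u w"
proof -
  define p where "p = chart_inv c x"
  have p: "p \<in> chart_dom c" "chart_map c p = x" "p \<in> topspace X"
    using x chart_dom_topspace[OF c] by (simp_all add: p_def)
  have "flat V p (tangent_of c p u) = local_form g c x (local_field V c x) u" for u
    using local_form_coord[OF c p(1) V_tangent[OF p(3)] tangent_of_in_tangent_space[OF c p(1), of u]] c p
    by (simp add: flat_def local_field_def p_def[symmetric])
  moreover have "g p (tangent_of c p u) (tangent_of c p w) = local_form g c x u w"
    by (simp add: local_form_def p_def)
  ultimately show ?thesis
    using homothetic[OF c p(1) tangent_of_in_tangent_space[OF c p(1), of u] tangent_of_in_tangent_space[OF c p(1), of w]]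
      c p by (simp add: lie_deriv_metric_def Let_def)
qed

lemma sqnorm_local:
  assumes c: "c \<in> atlas" and x: "x \<in> chart_image c"
  shows "sqnorm (chart_inv c x) = local_form g c x (local_field V c x) (local_field V c x)"
  using local_form_coord[OF c chart_inv_in_dom[OF x] V_tangent V_tangent] c x
    chart_dom_topspace[OF c chart_inv_in_dom[OF x]]
  by (simp add: local_field_def)

lemma sqnorm_has_derivative:
  assumes c: "c \<in> atlas" and x: "x \<in> chart_image c"
  defines "v \<equiv> local_field V c"
  shows "((\<lambda>y. sqnorm (chart_inv c y)) has_derivative
    (\<lambda>h. dir_deriv (\<lambda>y. local_form g c y (v x) (v x)) x h
      + local_form g c x (dir_deriv v x h) (v x) + local_form g c x (v x) (dir_deriv v x h))) (at x)"
proof -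
  have v: "(v has_derivative dir_deriv v x) (at x)"
    unfolding v_def by (rule C1_on_has_derivative[OF C1_on_local_field[OF c] x])
  have "((\<lambda>y. local_form g c y (v y) (v y)) has_derivative
    (\<lambda>h. dir_deriv (\<lambda>y. local_form g c y (v x) (v x)) x h
      + local_form g c x (dir_deriv v x h) (v x) + local_form g c x (v x) (dir_deriv v x h))) (at x)"
    by (rule has_derivative_bilinear_form[OF open_image[OF c] x bilinear_local_form[OF c]
        local_form_differentiable[OF c x] v v])
  then show ?thesis
    by (rule has_derivative_transform_within_open[OF _ open_image[OF c] x])
      (rule sqnorm_local[OF c, symmetric, folded v_def])
qed

lemma C0_fun_sqnorm: "C0_fun sqnorm"
  unfolding C0_fun_def
  using sqnorm_has_derivative has_derivative_continuous
  by (blast intro: continuous_at_imp_continuous_on)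

lemma C0_fun_divergence: "C0_fun divergence"
  using C0_fun_sqnorm m_pos unfolding C0_fun_def divergence_def by (auto intro!: continuous_intros)

lemma sqnorm_at_max:
  assumes p: "p \<in> topspace X" and max: "\<And>q. q \<in> topspace X \<Longrightarrow> sqnorm q \<le> sqnorm p"
  shows "sqnorm p = 0 \<or> sqnorm p = - (m * \<sigma>)"
proof -
  obtain c where c: "c \<in> atlas" "p \<in> chart_dom c"
    using chart_cover p by blast
  define x where "x = chart_map c p"
  have x: "x \<in> chart_image c" "chart_inv c x = p"
    using c by (simp_all add: x_def)
  let ?v = "local_field V c"
  have "sqnorm (chart_inv c y) \<le> sqnorm (chart_inv c x)" if "y \<in> chart_image c" for y
    using max[OF chart_dom_topspace[OF c(1) chart_inv_in_dom[OF that]]] x(2) by simp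
  then have "(\<lambda>h. dir_deriv (\<lambda>y. local_form g c y (?v x) (?v x)) x h
      + local_form g c x (dir_deriv ?v x h) (?v x) + local_form g c x (?v x) (dir_deriv ?v x h)) = (\<lambda>h. 0)"
    by (intro differential_zero_maxmin[OF x(1) open_image[OF c(1)] sqnorm_has_derivative[OF c(1) x(1)]]) blast
  \<comment> \<open>Evaluated at \<open>h = ?v x\<close>, the vanishing differential is precisely
    the coordinate expression of (L_V g)(V,V), so the first term of the equation drops out.\<close>
  then have "\<sigma> * sqnorm p + 1/m * (sqnorm p * sqnorm p) = 0"
    using homothetic_local[OF c(1) x(1), of "?v x" "?v x"] sqnorm_local[OF c(1) x(1)] x(2)
    by (simp add: fun_eq_iff)
  then have "sqnorm p * (m * \<sigma> + sqnorm p) = 0"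
    using m_pos by (simp add: field_simps)
  then show ?thesis
    by auto
qed

text \<open>The integrand is div (\<phi> V) times the density, in coordinates the sum of the partial
  derivatives of the components of \<phi> sqrt |det g| V. Extended by 0 these are C1 with compact
  support in the whole model space, where such a sum integrates to 0.\<close>

theorem integ_divergence_chart:
  assumes c: "c \<in> atlas" and P: "P \<subseteq> chart_dom c" "compactin X P"
    and \<phi>: "C1_fun \<phi>" and zero: "\<And>p. p \<in> topspace X - P \<Longrightarrow> \<phi> p = 0"
  shows "integ c (\<lambda>p. field_deriv V \<phi> p + \<phi> p * divergence p) = 0"
proof -
  let ?S = "chart_image c" and ?K = "chart_map c ` P"
  let ?f = "\<lambda>x. \<phi> (chart_inv c x)"
  let ?v = "local_field V c"
  let ?a = "\<lambda>x. ?f x * density c x"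
  let ?F = "\<lambda>b x. if x \<in> ?S then ?a x * (?v x \<bullet> b) else 0"
  have K: "compact ?K"
    using compact_chart_image c P by blast
  then have openK: "open (- ?K)"
    by (simp add: compact_imp_closed open_Compl)
  have f: "C1_on ?S ?f"
    using \<phi> c unfolding C1_fun_def by blast
  have a: "C1_on ?S ?a"
    by (intro C1_on_mult f C1_on_density c)
  have v: "C1_on ?S ?v"
    by (rule C1_on_local_field[OF c])
  have F0: "?F b x = 0" if "x \<notin> ?K" for b x
  proof (cases "x \<in> ?S")
    case True
    then have "chart_inv c x \<in> topspace X - P"
      using that chart_dom_topspace[OF c chart_inv_in_dom[OF True]] by (metis DiffI chart_map_inv image_eqI)
    then show ?thesis
      using zero by simp
  qed simp
  have "C1_on UNIV (?F b)" for b
  proof -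
    have "C1_on ?S (?F b)"
      by (rule C1_on_cong[OF open_image[OF c] _ C1_on_mult[OF a C1_on_inner[OF v, of b]]]) simp
    moreover have "C1_on (- ?K) (?F b)"
      using F0 by (intro C1_on_cong[OF openK _ C1_on_const[of _ 0]]) simp
    ultimately have "C1_on (?S \<union> - ?K) (?F b)"
      by (intro C1_on_Un open_image openK c)
    \<comment> \<open>The extension by 0 is C1 on the chart image and, being 0 there, on the
      complement of the compact set \<open>?K\<close>; these two open sets cover the space.\<close>
    moreover have "?S \<union> - ?K = UNIV"
      using P(1) by (auto simp: chart_image_def)
    ultimately show ?thesis
      by simp
  qed
  then have "integral UNIV (\<lambda>x. \<Sum>b\<in>Basis. dir_deriv (?F b) x b) = 0"
    by (rule integral_divergence_eq_0[OF _ K F0])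
  moreover have "(\<Sum>b\<in>Basis. dir_deriv (?F b) x b)
      = (if x \<in> ?S then (field_deriv V \<phi> (chart_inv c x) + \<phi> (chart_inv c x) * divergence (chart_inv c x)) * density c x else 0)"
    for x
  proof (cases "x \<in> ?S")
    case x: True
    obtain B where B: "B ** gram c x = mat 1"
      using gram_left_inverse[OF c x] .
    let ?H = "\<chi> i j. dir_deriv (\<lambda>y. local_form g c y (basis_vec i) (basis_vec j)) x (?v x)"
    have da: "(?a has_derivative (\<lambda>h. ?f x * dir_deriv (density c) x h + dir_deriv ?f x h * density c x)) (at x)"
      by (intro has_derivative_mult C1_on_has_derivative[OF f x] C1_on_has_derivative[OF C1_on_density[OF c] x])
    have la: "linear (dir_deriv ?a x)"
      using C1_on_has_derivative[OF a x] has_derivative_linear by blast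
    have "dir_deriv (?F b) x b = ?a x * (dir_deriv ?v x b \<bullet> b) + dir_deriv ?a x b * (?v x \<bullet> b)" for b
    proof -
      have "dir_deriv (?F b) x = dir_deriv (\<lambda>x. ?a x * (?v x \<bullet> b)) x"
        by (rule dir_deriv_cong[OF open_image[OF c] x]) simp
      also have "\<dots> = (\<lambda>h. ?a x * (dir_deriv ?v x h \<bullet> b) + dir_deriv ?a x h * (?v x \<bullet> b))"
        by (intro frechet_derivative_at[symmetric] has_derivative_mult has_derivative_inner_left
            C1_on_has_derivative[OF a x] C1_on_has_derivative[OF v x])
      finally show ?thesis by simp
    qed
    then have "(\<Sum>b\<in>Basis. dir_deriv (?F b) x b)
        = ?a x * (\<Sum>b\<in>Basis. dir_deriv ?v x b \<bullet> b) + (\<Sum>b\<in>Basis. (?v x \<bullet> b) * dir_deriv ?a x b)"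
      by (simp only: sum.distrib sum_distrib_left mult.commute[of _ "?v x \<bullet> _"])
    also have "(\<Sum>b\<in>Basis. (?v x \<bullet> b) * dir_deriv ?a x b) = dir_deriv ?a x (\<Sum>b\<in>Basis. (?v x \<bullet> b) *\<^sub>R b)"
      by (simp only: linear_sum[OF la] linear_scale[OF la] real_scaleR_def)
    also have "\<dots> = ?f x * dir_deriv (density c) x (?v x) + dir_deriv ?f x (?v x) * density c x"
      by (simp add: euclidean_representation frechet_derivative_at[OF da, symmetric])
    also have "dir_deriv (density c) x (?v x) = density c x * trace (B ** ?H) / 2"
      using frechet_derivative_at[OF density_has_derivative[OF c x B]] by metis
    finally have "(\<Sum>b\<in>Basis. dir_deriv (?F b) x b)
        = (dir_deriv ?f x (?v x) + ?f x * (trace (B ** ?H) / 2 + (\<Sum>b\<in>Basis. dir_deriv ?v x b \<bullet> b))) * density c x"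
      by (simp add: algebra_simps)
    \<comment> \<open>The derivative of the density along V supplies the first summand and the
      derivatives of the components of V the second; the traced homothety equation evaluates their
      sum.\<close>
    also have "trace (B ** ?H) / 2 + (\<Sum>b\<in>Basis. dir_deriv ?v x b \<bullet> b) = divergence (chart_inv c x)"
      unfolding divergence_def sqnorm_local[OF c x]
      using homothetic_local[OF c x] B
      by (intro trace_homothetic_equation bilinear_local_form[OF c x] local_form_sym[OF c x]) (simp_all add: gram_def)
    also have "dir_deriv ?f x (?v x) = field_deriv V \<phi> (chart_inv c x)"
      using field_deriv_eq[where V=V and p="chart_inv c x", OF \<phi> V_tangent c] x chart_dom_topspace[OF c chart_inv_in_dom[OF x]]
      by (simp add: local_field_def)
    finally show ?thesis
      using x by simp
  next
    case False
    then have "x \<notin> ?K"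
      using P(1) by (auto simp: chart_image_def)
    then have "dir_deriv (?F b) x = dir_deriv (\<lambda>_. 0) x" for b
      using F0 by (intro dir_deriv_cong[OF openK]) auto
    then show ?thesis
      using False by simp
  qed
  ultimately show ?thesis
    by (simp add: integ_def integral_restrict_UNIV)
qed

lemma integ_cong:
  assumes "c \<in> atlas" "\<And>p. p \<in> topspace X \<Longrightarrow> \<phi> p = \<psi> p"
  shows "integ c \<phi> = integ c \<psi>"
  unfolding integ_def
  using assms chart_dom_topspace[OF assms(1) chart_inv_in_dom] by (intro integral_cong) simp

text \<open>
  The left-hand side is the integral of \<open>divergence\<close> over \<open>X\<close>. With
  \<open>\<psi> i = div (\<rho> i V)\<close> one has \<open>divergence = (\<Sum>i. \<psi> i)\<close>, and each \<open>\<psi> i\<close> integrates to \<open>0\<close>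
  in the chart \<open>c i\<close>; the integrals of \<open>\<rho> j \<psi> i\<close> in the charts \<open>c i\<close> and \<open>c j\<close> agree.
\<close>

theorem integ_divergence:
  assumes F: "finite F"
    and c: "\<And>i. i \<in> F \<Longrightarrow> c i \<in> atlas" and P: "\<And>i. i \<in> F \<Longrightarrow> P i \<subseteq> chart_dom (c i)"
    and compact_P: "\<And>i. i \<in> F \<Longrightarrow> compactin X (P i)"
    and \<rho>: "\<And>i. i \<in> F \<Longrightarrow> C1_fun (\<rho> i)"
    and zero: "\<And>i q. i \<in> F \<Longrightarrow> q \<in> topspace X - P i \<Longrightarrow> \<rho> i q = 0"
    and one: "\<And>q. q \<in> topspace X \<Longrightarrow> (\<Sum>i\<in>F. \<rho> i q) = 1"
  shows "(\<Sum>j\<in>F. integ (c j) (\<lambda>q. \<rho> j q * divergence q)) = 0"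
proof -
  define \<psi> where "\<psi> i q = field_deriv V (\<rho> i) q + \<rho> i q * divergence q" for i q
  have C0: "C0_fun (\<psi> i)" if "i \<in> F" for i
    unfolding \<psi>_def using that
    by (intro C0_fun_add C0_fun_mult C0_fun_field_deriv smooth_V C0_fun_divergence C1_fun_imp_C0_fun \<rho>)
  have closed: "closedin X (P i)" if "i \<in> F" for i
    using compactin_imp_closedin Hausdorff compact_P[OF that] by blast
  have \<psi>_zero: "\<psi> i q = 0" if i: "i \<in> F" and q: "q \<in> topspace X - P i" for i q
  proof -
    have "openin X (topspace X - P i)"
      using closed[OF i] by blast
    then have "field_deriv V (\<rho> i) q = 0"
      using q by (intro field_deriv_zero[where V=V and p=q and k=0, OF \<rho>[OF i] V_tangent _ q zero[OF i]]) auto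
    then show ?thesis
      using zero[OF i q] by (simp add: \<psi>_def)
  qed
  have sum_\<psi>: "(\<Sum>i\<in>F. \<psi> i q) = divergence q" if q: "q \<in> topspace X" for q
  proof -
    \<comment> \<open>The terms V(\<rho> i) add up to the derivative of the constant 1, so only
      \<open>divergence\<close> survives.\<close>
    have "(\<Sum>i\<in>F. field_deriv V (\<rho> i) q) = field_deriv V (\<lambda>q. \<Sum>i\<in>F. \<rho> i q) q"
      using field_deriv_sum[where V=V and p=q and \<phi>=\<rho> and I=F] \<rho> V_tangent[OF q] q by simp
    also have "\<dots> = 0"
      by (rule field_deriv_zero[where V=V and p=q and k=1, OF C1_fun_sum V_tangent[OF q] openin_topspace q one]) (rule \<rho>)
    finally show ?thesis
      unfolding \<psi>_def sum.distrib sum_distrib_right[symmetric] one[OF q] by simp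
  qed
  have sum_\<rho>: "integ (c i) (\<psi> i) = (\<Sum>j\<in>F. integ (c i) (\<lambda>q. \<rho> j q * \<psi> i q))" if i: "i \<in> F" for i
  proof -
    have "integ (c i) (\<psi> i) = integ (c i) (\<lambda>q. \<Sum>j\<in>F. \<rho> j q * \<psi> i q)"
      by (rule integ_cong[OF c[OF i]]) (simp add: sum_distrib_right[symmetric] one)
    also have "\<dots> = (\<Sum>j\<in>F. integ (c i) (\<lambda>q. \<rho> j q * \<psi> i q))"
      using compact_chart_image[OF c[OF i] compact_P[OF i] P[OF i]] \<psi>_zero[OF i]
      by (intro integ_sum[OF c[OF i] P[OF i]] C0_fun_mult C0 i C1_fun_imp_C0_fun \<rho> F) auto
    finally show ?thesis .
  qed
  have sum_\<psi>': "integ (c j) (\<lambda>q. \<rho> j q * divergence q) = (\<Sum>i\<in>F. integ (c j) (\<lambda>q. \<rho> j q * \<psi> i q))"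
    if j: "j \<in> F" for j
  proof -
    have "integ (c j) (\<lambda>q. \<rho> j q * divergence q) = integ (c j) (\<lambda>q. \<Sum>i\<in>F. \<rho> j q * \<psi> i q)"
      by (rule integ_cong[OF c[OF j]]) (simp add: sum_distrib_left[symmetric] sum_\<psi>)
    also have "\<dots> = (\<Sum>i\<in>F. integ (c j) (\<lambda>q. \<rho> j q * \<psi> i q))"
      using compact_chart_image[OF c[OF j] compact_P[OF j] P[OF j]] zero[OF j]
      by (intro integ_sum[OF c[OF j] P[OF j]] C0_fun_mult C0 j C1_fun_imp_C0_fun \<rho> F) auto
    finally show ?thesis .
  qed
  have change: "integ (c i) (\<lambda>q. \<rho> j q * \<psi> i q) = integ (c j) (\<lambda>q. \<rho> j q * \<psi> i q)"
    if i: "i \<in> F" and j: "j \<in> F" for i j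
  \<comment> \<open>The product vanishes off \<open>P i \<inter> P j\<close>, a compact set
    contained in both chart domains.\<close>
  proof (rule integ_chart_change[of "c i" "P i \<inter> P j"])
    have "compactin X (P i \<inter> P j)"
      using closed_Int_compactin[OF closed[OF i] compact_P[OF j]] by simp
    then show "compact (chart_map (c i) ` (P i \<inter> P j))"
      using P[OF i] by (intro compact_chart_image c i) auto
    show "C0_fun (\<lambda>q. \<rho> j q * \<psi> i q)"
      by (intro C0_fun_mult C0 i j C1_fun_imp_C0_fun \<rho>)
    show "\<rho> j q * \<psi> i q = 0" if "q \<in> topspace X - P i \<inter> P j" for q
      using that zero[OF j] \<psi>_zero[OF i] by auto
  qed (use c i j P in auto)
  have "(\<Sum>j\<in>F. integ (c j) (\<lambda>q. \<rho> j q * divergence q))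
      = (\<Sum>j\<in>F. \<Sum>i\<in>F. integ (c i) (\<lambda>q. \<rho> j q * \<psi> i q))"
    by (simp add: sum_\<psi>' change)
  also have "\<dots> = (\<Sum>i\<in>F. integ (c i) (\<psi> i))"
    by (subst sum.swap) (simp add: sum_\<rho>)
  also have "\<dots> = 0"
  proof (intro sum.neutral ballI)
    show "integ (c i) (\<psi> i) = 0" if i: "i \<in> F" for i
      unfolding \<psi>_def
      by (rule integ_divergence_chart[OF c[OF i] P[OF i] compact_P[OF i] \<rho>[OF i] zero[OF i]])
  qed
  finally show ?thesis .
qed

text \<open>Were the divergence negative everywhere, every weighted integral of its negative would
  be nonnegative and at least one positive, whereas they add up to 0.\<close>

lemma divergence_not_neg:
  assumes compact: "compact_space X" and ne: "topspace X \<noteq> {}"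
  shows "\<exists>p\<in>topspace X. divergence p \<ge> 0"
proof (rule ccontr)
  assume "\<not> ?thesis"
  then have neg: "divergence p < 0" if "p \<in> topspace X" for p
    using that by force
  obtain F :: "'m set" and c P \<rho> where F: "finite F"
    and part: "\<forall>i\<in>F. c i \<in> atlas \<and> P i \<subseteq> chart_dom (c i) \<and> compactin X (P i) \<and> C1_fun (\<rho> i)"
      "\<forall>i\<in>F. \<forall>q\<in>topspace X. \<rho> i q \<ge> 0"
      "\<forall>i\<in>F. \<forall>q\<in>topspace X - P i. \<rho> i q = 0"
      "\<forall>q\<in>topspace X. (\<Sum>i\<in>F. \<rho> i q) = 1"
    by (rule partition_of_unity[OF compact])
  note * = bspec[OF part(1)] and nonneg = bspec[OF bspec[OF part(2)]]
    and zero = bspec[OF bspec[OF part(3)]] and one = bspec[OF part(4)]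
  let ?f = "\<lambda>j x. \<rho> j (chart_inv (c j) x) * - divergence (chart_inv (c j) x) * density (c j) x"
  have atlas: "c j \<in> atlas" if "j \<in> F" for j
    using *[OF that] by blast
  have f_nonneg: "?f j x \<ge> 0" if j: "j \<in> F" and x: "x \<in> chart_image (c j)" for j x
  proof -
    have "chart_inv (c j) x \<in> topspace X"
      by (rule chart_dom_topspace[OF atlas[OF j] chart_inv_in_dom[OF x]])
    then show ?thesis
      using nonneg[OF j] neg density_pos[OF atlas[OF j] x] by (intro mult_nonneg_nonneg) (simp_all add: less_imp_le)
  qed
  have C0: "C0_fun (\<lambda>q. \<rho> j q * - divergence q)" if "j \<in> F" for j
    using C0_fun_divergence C1_fun_imp_C0_fun[of "\<rho> j"] *[OF that]
    unfolding C0_fun_def by (intro ballI continuous_intros) blast+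
  have int: "?f j integrable_on chart_image (c j)" if j: "j \<in> F" for j
    using *[OF j] zero[OF j] compact_chart_image[of "c j" "P j"]
    by (intro set_lebesgue_integral_eq_integral(1) compact_support_integrand[OF _ _ _ C0[OF j], where P="P j"]) auto
  have integ_eq: "integ (c j) (\<lambda>q. \<rho> j q * divergence q) = - integral (chart_image (c j)) (?f j)" for j
    unfolding integ_def by (simp flip: integral_neg)
  obtain p where p: "p \<in> topspace X"
    using ne by blast
  \<comment> \<open>The functions sum to 1 at \<open>p\<close>, so one of them is nonzero there;
    this also puts \<open>p\<close> into \<open>P k\<close> and hence into the domain of
    \<open>c k\<close>.\<close>
  then obtain k where k: "k \<in> F" "\<rho> k p \<noteq> 0"
    using one[OF p] by (metis sum.neutral zero_neq_one)
  have pk: "p \<in> chart_dom (c k)"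
    using k zero[OF k(1)] p *[OF k(1)] by blast
  have "integral (chart_image (c k)) (?f k) > 0"
  proof (rule integral_pos_continuous)
    note ck = atlas[OF k(1)]
    show "open (chart_image (c k))"
      by (rule open_image[OF ck])
    show "continuous_on (chart_image (c k)) (?f k)"
      using C0[OF k(1)] ck unfolding C0_fun_def
      by (intro continuous_on_mult[OF _ C1_on_continuous[OF C1_on_density[OF ck]]]) blast
    show "chart_map (c k) p \<in> chart_image (c k)"
      using pk by simp
    then show "?f k (chart_map (c k) p) > 0"
      using density_pos[OF ck] neg[OF p] nonneg[OF k(1) p] k(2) ck pk by (auto simp: mult_less_0_iff)
  qed (use int f_nonneg k in auto)
  then have "(\<Sum>j\<in>F. integral (chart_image (c j)) (?f j)) > 0"
    using F k int f_nonneg by (intro sum_pos2[of F k] integral_nonneg) auto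
  moreover have "(\<Sum>j\<in>F. integ (c j) (\<lambda>q. \<rho> j q * divergence q)) = 0"
    using F * zero one by (intro integ_divergence[where P=P]) auto
  ultimately show False
    by (simp add: integ_eq sum_negf)
qed

theorem compact_imp_zero_field:
  assumes compact: "compact_space X" and dim: "DIM('e) \<ge> 2"
  shows "zero_field V"
proof (cases "topspace X = {}")
  case True
  then show ?thesis
    unfolding zero_field_def by blast
next
  case False
  obtain p where p: "p \<in> topspace X" and max: "\<And>q. q \<in> topspace X \<Longrightarrow> sqnorm q \<le> sqnorm p"
    using C0_fun_attains_max[OF C0_fun_sqnorm compact False] by blast
  have pos: "sqnorm q > 0" if "q \<in> topspace X" "V q \<noteq> (\<lambda>c. 0)" for q
    using metric_pos V_tangent that by blast
  show ?thesis
  proof (rule ccontr)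
    assume "\<not> zero_field V"
    then obtain q where "q \<in> topspace X" "V q \<noteq> (\<lambda>c. 0)"
      unfolding zero_field_def by blast
    then have "sqnorm p > 0"
      using pos max by fastforce
    \<comment> \<open>A positive maximum rules out the first alternative, and with
      \<open>m > 0\<close> the second one makes \<sigma> negative.\<close>
    with sqnorm_at_max[OF p max] have eq: "sqnorm p = - (m * \<sigma>)" and \<sigma>: "\<sigma> < 0"
      using m_pos by (auto simp: mult_less_0_iff)
    obtain r where r: "r \<in> topspace X" "divergence r \<ge> 0"
      using divergence_not_neg[OF compact False] by blast
    have "sqnorm r / m \<le> - \<sigma>"
      using max[OF r(1)] m_pos unfolding eq by (simp add: field_simps)
    then have "divergence r \<le> \<sigma> * (real DIM('e) - 1)"
      by (simp add: divergence_def algebra_simps)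
    \<comment> \<open>Dimension at least 2 makes the second factor positive; in dimension 1 it would
      be 0, leaving only \<open>divergence r \<le> 0\<close>.\<close>
    moreover have "\<sigma> * (real DIM('e) - 1) < 0"
      using \<sigma> dim by (intro mult_neg_pos) auto
    ultimately show False
      using r(2) by simp
  qed
qed

end

theorem theorem2p1:
  fixes X :: "'m topology"
    and atlas :: "('m, 'e::euclidean_space) chart set"
    and g :: "'m \<Rightarrow> (('m, 'e) chart \<Rightarrow> 'e) \<Rightarrow> (('m, 'e) chart \<Rightarrow> 'e) \<Rightarrow> real"
    and V :: "'m \<Rightarrow> ('m, 'e) chart \<Rightarrow> 'e"
    and m :: real
  assumes "riemannian_manifold X atlas g"
    and "compact_space X"
    and "DIM('e) \<ge> 2"
    and "m > 0"
    and "riemannian_manifold.modified_homothetic X atlas g m V"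
  shows "smooth_manifold.zero_field X V"
proof -
  interpret riemannian_manifold X atlas g by fact
  obtain \<sigma> where V: "smooth_vector_field V"
    "\<forall>c\<in>atlas. \<forall>p\<in>chart_dom c. \<forall>\<xi>\<in>tangent_space p. \<forall>\<eta>\<in>tangent_space p.
       1/2 * lie_deriv_metric V c p \<xi> \<eta> - 1/m * (flat V p \<xi> * flat V p \<eta>) = \<sigma> * g p \<xi> \<eta>"
    using assms(5) unfolding modified_homothetic_def by blast
  interpret modified_homothetic_field X atlas g V m \<sigma>
    using V assms(4) by unfold_locales blast+
  show ?thesis
    using assms(2,3) by (rule compact_imp_zero_field)
qed

end
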